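(* Let $G=\langle a,t\mid (tat^{-1})\,a\,(tat^{-1})^{-1}=a^{2}\rangle$ be the Baumslag-Gersten group. Then its conjugator length function satisfies $\mathrm{CL}_G(n)\simeq E(\lfloor \log_2 n\rfloor,1)$.
   Context: Conjugator length: let $H=\langle S\mid R\rangle$ be a finitely presented group with a fixed finite presentation, and let $|h|_H$ denote the minimal length of a word on $S$ (letters from $S$ and their inverses) representing $h\in H$. For words $u,v$ on $S$ representing conjugate elements of $H$, $c(u,v)$ is the smallest value of $|\gamma|_H$ over all $\gamma\in H$ conjugating $u$ to $v$. The conjugator length function $\mathrm{CL}_H(n)$ is the maximum of $c(u,v)$ over all conjugate pairs $(u,v)$ with $|u|_H+|v|_H\leq n$. Its $\simeq$-class does not depend on the chosen finite presentation. Equivalence: for $f,g:\mathbb{N}\to\mathbb{N}$, write $f(n)\preceq g(n)$ if there exists $C>0$ such that $f(n)\leq C g(Cn+C)+Cn+C$ for all $n\in\mathbb{N}$, and $f(n)\simeq g(n)$ if $f\preceq g$ and $g\preceq f$. Iterated exponential: $E(0,n)=n$ and $E(m,n)=2^{E(m-1,n)}$ for $m\geq 1$. The function $n\mapsto E(\lfloor\log_2 n\rfloor,1)$ is considered for $n\geq 1$ (at $n=0$ it may be assigned the value $1$; this does not affect the $\simeq$-class). *)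

theory Defs
  imports Complex_Main "HOL-Algebra.Group"
begin

section \<open>Groups given by presentations\<close>

text \<open>
  A word on the generators is a list of letters; \<open>(x, True)\<close> stands for the generator \<open>x\<close> and
  \<open>(x, False)\<close> for its inverse. The generating set of a presentation is the whole type \<open>'a\<close>.
\<close>

type_synonym 'a gword = "('a \<times> bool) list"

definition inv_word :: "'a gword \<Rightarrow> 'a gword" where
  "inv_word w = rev (map (\<lambda>(x, b). (x, \<not> b)) w)"

text \<open>Two words represent the same element of \<open>\<langle>'a | R\<rangle>\<close> iff one is turned into the other by
  finitely many insertions and deletions of inverse pairs and of relators.\<close>

inductive pres_eq :: "'a gword set \<Rightarrow> 'a gword \<Rightarrow> 'a gword \<Rightarrow> bool" for R where
  pres_refl: "pres_eq R w w"
| pres_sym: "pres_eq R v w \<Longrightarrow> pres_eq R w v"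
| pres_trans: "pres_eq R u v \<Longrightarrow> pres_eq R v w \<Longrightarrow> pres_eq R u w"
| pres_cancel: "pres_eq R (u @ [(x, b), (x, \<not> b)] @ v) (u @ v)"
| pres_relator: "r \<in> R \<Longrightarrow> pres_eq R (u @ r @ v) (u @ v)"

definition pres_rel :: "'a gword set \<Rightarrow> ('a gword \<times> 'a gword) set" where
  "pres_rel R = {(v, w). pres_eq R v w}"

definition word_elt :: "'a gword set \<Rightarrow> 'a gword \<Rightarrow> 'a gword set" where
  "word_elt R w = pres_rel R `` {w}"

definition presented_group :: "'a gword set \<Rightarrow> 'a gword set monoid" where
  "presented_group R =
     \<lparr>carrier = UNIV // pres_rel R,
      monoid.mult = (\<lambda>X Y. \<Union>u\<in>X. \<Union>v\<in>Y. word_elt R (u @ v)),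
      one = word_elt R []\<rparr>"

lemma equiv_pres_rel: "equiv UNIV (pres_rel R)"
  by (rule equivI) (auto simp: pres_rel_def refl_on_def sym_def trans_def
      intro: pres_refl pres_sym pres_trans)

lemma word_elt_eq_iff: "word_elt R v = word_elt R w \<longleftrightarrow> pres_eq R v w"
  using eq_equiv_class_iff[OF equiv_pres_rel, of v w R]
  by (simp add: word_elt_def pres_rel_def)

lemma in_word_elt_iff: "v \<in> word_elt R w \<longleftrightarrow> pres_eq R w v"
  by (simp add: word_elt_def pres_rel_def)

lemma pres_eq_append_ctxt: "pres_eq R v w \<Longrightarrow> pres_eq R (x @ v @ y) (x @ w @ y)"
proof (induction rule: pres_eq.induct)
  case (pres_cancel u z b v)
  then show ?case using pres_eq.pres_cancel[of R "x @ u" z b "v @ y"] by simp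
next
  case (pres_relator r u v)
  then show ?case using pres_eq.pres_relator[of r R "x @ u" "v @ y"] by simp
qed (blast intro: pres_refl pres_sym pres_trans)+

lemma pres_eq_append:
  assumes "pres_eq R v v'" "pres_eq R w w'"
  shows "pres_eq R (v @ w) (v' @ w')"
  using pres_eq_append_ctxt[OF assms(1), of "[]" w] pres_eq_append_ctxt[OF assms(2), of v' "[]"]
  by (auto intro: pres_trans)

lemma pres_eq_inv_word: "pres_eq R (inv_word w @ w) []"
proof (induction w)
  case (Cons l w)
  obtain x b where l: "l = (x, b)" by (cases l)
  have "pres_eq R (inv_word w @ [(x, \<not> b), (x, \<not> \<not> b)] @ w) (inv_word w @ w)"
    by (rule pres_cancel)
  then show ?case using Cons by (auto simp: inv_word_def l intro: pres_trans)
qed (simp add: inv_word_def pres_refl)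

lemma carrier_presented_group: "carrier (presented_group R) = range (word_elt R)"
  by (auto simp: presented_group_def quotient_def word_elt_def)

lemma mult_presented_group:
  "word_elt R v \<otimes>\<^bsub>presented_group R\<^esub> word_elt R w = word_elt R (v @ w)"
proof -
  have "word_elt R (v' @ w') = word_elt R (v @ w)"
    if "v' \<in> word_elt R v" "w' \<in> word_elt R w" for v' w'
  proof -
    have "pres_eq R (v @ w) (v' @ w')"
      using that by (intro pres_eq_append) (simp_all add: in_word_elt_iff)
    then show ?thesis unfolding word_elt_eq_iff by (rule pres_sym)
  qed
  moreover have "v \<in> word_elt R v" "w \<in> word_elt R w"
    by (simp_all add: in_word_elt_iff pres_refl)
  ultimately have "(\<Union>v'\<in>word_elt R v. \<Union>w'\<in>word_elt R w. word_elt R (v' @ w')) = word_elt R (v @ w)"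
    by blast
  then show ?thesis by (simp add: presented_group_def)
qed

lemma one_presented_group: "\<one>\<^bsub>presented_group R\<^esub> = word_elt R []"
  by (simp add: presented_group_def)

lemma group_presented_group: "group (presented_group R)"
proof (rule groupI, goal_cases)
  case (5 X)
  then obtain w where w: "X = word_elt R w" by (auto simp: carrier_presented_group)
  have "word_elt R (inv_word w) \<otimes>\<^bsub>presented_group R\<^esub> X = \<one>\<^bsub>presented_group R\<^esub>"
    by (simp add: w mult_presented_group one_presented_group word_elt_eq_iff pres_eq_inv_word)
  then show ?case by (auto simp: carrier_presented_group)
qed (auto simp: carrier_presented_group mult_presented_group one_presented_group)

section \<open>Conjugator length\<close>

definition elt_length :: "'a gword set \<Rightarrow> 'a gword set \<Rightarrow> nat" where
  "elt_length R h = (LEAST n. \<exists>w. word_elt R w = h \<and> length w = n)"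

definition conjugators :: "'a gword set \<Rightarrow> 'a gword \<Rightarrow> 'a gword \<Rightarrow> 'a gword set set" where
  "conjugators R u v =
     {\<gamma> \<in> carrier (presented_group R).
        \<gamma> \<otimes>\<^bsub>presented_group R\<^esub> word_elt R u
          \<otimes>\<^bsub>presented_group R\<^esub> inv\<^bsub>presented_group R\<^esub> \<gamma> = word_elt R v}"

definition conj_dist :: "'a gword set \<Rightarrow> 'a gword \<Rightarrow> 'a gword \<Rightarrow> nat" where
  "conj_dist R u v = (LEAST n. \<exists>\<gamma> \<in> conjugators R u v. elt_length R \<gamma> = n)"

definition conj_dists :: "'a gword set \<Rightarrow> nat \<Rightarrow> nat set" where
  "conj_dists R n =
     {conj_dist R u v | u v. conjugators R u v \<noteq> {} \<and>
        elt_length R (word_elt R u) + elt_length R (word_elt R v) \<le> n}"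

definition CL :: "'a gword set \<Rightarrow> nat \<Rightarrow> nat" where
  "CL R n = Max (conj_dists R n)"

text \<open>On a finite generating set the maximum is taken over a finite nonempty set.\<close>

lemma elt_length_witness: "\<exists>w. word_elt R w = word_elt R u \<and> length w = elt_length R (word_elt R u)"
  unfolding elt_length_def by (rule LeastI_ex) blast

lemma finite_conj_dists: "finite (conj_dists (R :: 'a::finite gword set) n)"
proof -
  let ?W = "{w :: 'a gword. set w \<subseteq> UNIV \<and> length w \<le> n}"
  have "conj_dists R n \<subseteq> (\<lambda>(u, v). conj_dist R u v) ` (?W \<times> ?W)"
  proof
    fix k assume "k \<in> conj_dists R n"
    then obtain u v where k: "k = conj_dist R u v"
      and le: "elt_length R (word_elt R u) + elt_length R (word_elt R v) \<le> n"
      by (auto simp: conj_dists_def)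
    obtain u' where u': "word_elt R u' = word_elt R u" "length u' = elt_length R (word_elt R u)"
      using elt_length_witness by blast
    obtain v' where v': "word_elt R v' = word_elt R v" "length v' = elt_length R (word_elt R v)"
      using elt_length_witness by blast
    have "k = conj_dist R u' v'"
      by (simp add: k conj_dist_def conjugators_def u'(1) v'(1))
    moreover have "(u', v') \<in> ?W \<times> ?W" using le u'(2) v'(2) by auto
    ultimately show "k \<in> (\<lambda>(u, v). conj_dist R u v) ` (?W \<times> ?W)"
      by (intro image_eqI[where x = "(u', v')"]) simp_all
  qed
  moreover have "finite ?W" by (rule finite_lists_length_le) simp
  ultimately show ?thesis by (meson finite_SigmaI finite_imageI finite_subset)
qed

lemma conj_dists_nonempty: "conj_dists R n \<noteq> {}"
proof -
  interpret group "presented_group R" by (rule group_presented_group)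
  have "\<one>\<^bsub>presented_group R\<^esub> \<in> conjugators R [] []"
    by (simp add: conjugators_def flip: one_presented_group)
  moreover have "elt_length R (word_elt R []) = 0"
    unfolding elt_length_def by (rule Least_equality) auto
  ultimately have "conj_dist R [] [] \<in> conj_dists R n"
    unfolding conj_dists_def by (intro CollectI exI[of _ "[]"]) auto
  then show ?thesis by blast
qed

section \<open>Comparison of growth functions\<close>

definition growth_le :: "(nat \<Rightarrow> nat) \<Rightarrow> (nat \<Rightarrow> nat) \<Rightarrow> bool" (infix "\<preceq>" 50) where
  "f \<preceq> g \<longleftrightarrow> (\<exists>C>0. \<forall>n. f n \<le> C * g (C * n + C) + C * n + C)"

definition growth_equiv :: "(nat \<Rightarrow> nat) \<Rightarrow> (nat \<Rightarrow> nat) \<Rightarrow> bool" (infix "\<simeq>" 50) where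
  "f \<simeq> g \<longleftrightarrow> f \<preceq> g \<and> g \<preceq> f"

fun iter_exp :: "nat \<Rightarrow> nat \<Rightarrow> nat" where
  "iter_exp 0 n = n"
| "iter_exp (Suc m) n = 2 ^ iter_exp m n"

definition tower_log :: "nat \<Rightarrow> nat" where
  "tower_log n = (if n = 0 then 1 else iter_exp (nat \<lfloor>log 2 (real n)\<rfloor>) 1)"

section \<open>The Baumslag--Gersten group\<close>

datatype bg_gen = Gen_a | Gen_t

instance bg_gen :: finite
proof
  have "(UNIV :: bg_gen set) \<subseteq> {Gen_a, Gen_t}" using bg_gen.exhaust by blast
  then show "finite (UNIV :: bg_gen set)" by (rule finite_subset) simp
qed

abbreviation bg_a :: "bg_gen gword" where "bg_a \<equiv> [(Gen_a, True)]"
abbreviation bg_t :: "bg_gen gword" where "bg_t \<equiv> [(Gen_t, True)]"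

definition bg_relators :: "bg_gen gword set" where
  "bg_relators =
     (let s = bg_t @ bg_a @ inv_word bg_t
      in {(s @ bg_a @ inv_word s) @ inv_word (bg_a @ bg_a)})"

end

theory Submission
  imports Defs
begin

text \<open>
  The group is an HNN extension of the Baumslag--Solitar group \<open>\<langle>a, s | s a s\<^sup>-\<^sup>1 = a\<^sup>2\<rangle>\<close>, the semidirect
  product of the dyadic rationals and the integers, with stable letter \<open>t\<close> conjugating \<open>a\<close> to
  \<open>s\<close>. To return to exponent 0 after raising the power of \<open>s\<close> to some \<open>k\<close>, a word needs one subword
  producing \<open>k\<close> and another one producing \<open>-k\<close>; so \<open>2\<^sup>k\<close> is reached only at twice the length, and
  the exponents occurring in words of length \<open>n\<close> are towers of height \<open>log\<^sub>2 n + O(1)\<close>.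

  Upper bound: after a cyclic reduction, Collins' lemma leaves a conjugator in the
  Baumslag--Solitar group that solves explicit equations in these exponents.
  Lower bound: \<open>s\<^sup>2\<close> and \<open>a\<^bsup>1-4^n\<^esup> s\<^sup>2\<close> are conjugate, and each conjugator starts with the translation
  by \<open>(4\<^sup>n - 1) / 3\<close>, whose binary expansion \<open>1010\<dots>1\<close> forces length of order \<open>n\<close>, while
  \<open>a\<^bsup>4^n\<^esup>\<close> is short when \<open>4\<^sup>n\<close> is a tower of twos.
\<close>

section \<open>Multiples in a group\<close>

text \<open>The comparison of growth functions allows a constant factor in the argument, and such a
  factor changes the height of the tower by a constant. One more exponential is therefore harmless:
  integers of size 2^O(growth n) may be spelled out letter by letter in a conjugator, and most
  constants are crude. Only the halving in \<open>growth\<close> must be exact.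

  Lower bound: the size of an exponent says nothing about length, since huge powers of a can be
  short; what is expensive is a dense binary expansion. With s in place of s^2 the conjugating
  translation would come from dividing by 1 - 2 = -1 and be as short as the data. For s^2 the
  divisor is 1 - 4 = -3, which turns the sparse number 4^n - 1 into a dense one.

  Upper bound: a conjugator of two elliptic elements (those conjugate into the Baumslag-Solitar
  group) may cross many letters t, each exchanging a^j and s^j. The odd part q of j survives all of
  this, so a^q serves as a common representative and the given conjugator can be discarded.

  Britton's lemma is obtained from an action on normal forms.\<close>

lemmas group_simps = add.assoc minus_add diff_conv_add_uminus

primrec nat_mul :: "nat \<Rightarrow> 'a::group_add \<Rightarrow> 'a" where
  "nat_mul 0 x = 0"
| "nat_mul (Suc n) x = x + nat_mul n x"

definition int_mul :: "int \<Rightarrow> 'a::group_add \<Rightarrow> 'a" where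
  "int_mul z x = (if z \<ge> 0 then nat_mul (nat z) x else - nat_mul (nat (- z)) x)"

lemma nat_mul_commute: "nat_mul n x + x = x + nat_mul n x"
  by (induction n) (simp_all add: add.assoc)

lemma int_mul_0 [simp]: "int_mul 0 x = 0"
  by (simp add: int_mul_def)

lemma int_mul_1 [simp]: "int_mul 1 x = x"
  by (simp add: int_mul_def)

lemma int_mul_Suc: "int_mul (z + 1) x = x + int_mul z x"
proof (cases "z \<ge> 0")
  case True
  then have "nat (z + 1) = Suc (nat z)" by simp
  with True show ?thesis by (simp add: int_mul_def)
next
  case False
  define m where "m = nat (- z - 1)"
  have z: "z = - int m - 1" using False by (simp add: m_def)
  have "nat (- z) = Suc m" using z by simp
  moreover have "int_mul (z + 1) x = - nat_mul m x"
    using z by (cases "m = 0") (simp_all add: int_mul_def)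
  moreover have "- nat_mul m x = x + - (x + nat_mul m x)"
    unfolding nat_mul_commute[symmetric] by (simp add: group_simps del: add_uminus_conv_diff)
  ultimately show ?thesis using False by (simp add: int_mul_def)
qed

lemma int_mul_pred: "int_mul (z - 1) x = - x + int_mul z x"
  using int_mul_Suc[of "z - 1" x] by (simp add: group_simps del: add_uminus_conv_diff)

lemma int_mul_add: "int_mul (i + j) x = int_mul i x + int_mul j x"
proof (induction i rule: int_induct[where k = 0])
  case (step1 i)
  have "int_mul (i + 1 + j) x = int_mul ((i + j) + 1) x" by (simp add: algebra_simps)
  also have "\<dots> = x + (int_mul i x + int_mul j x)" by (simp only: int_mul_Suc step1)
  finally show ?case by (simp only: int_mul_Suc add.assoc)
next
  case (step2 i)
  have "int_mul (i - 1 + j) x = int_mul ((i + j) - 1) x" by (simp add: algebra_simps)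
  also have "\<dots> = - x + (int_mul i x + int_mul j x)" by (simp only: int_mul_pred step2)
  finally show ?case by (simp only: int_mul_pred add.assoc)
qed simp

lemma int_mul_minus: "int_mul (- i) x = - int_mul i x"
  using int_mul_add[of "- i" i x] by (simp add: eq_neg_iff_add_eq_0)

lemma int_mul_neg_1 [simp]: "int_mul (- 1) x = - x"
  by (simp add: int_mul_minus)

lemma int_mul_double: "int_mul z (x + x) = int_mul (2 * z) x"
proof (induction z rule: int_induct[where k = 0])
  case (step1 i)
  have "int_mul (2 * (i + 1)) x = int_mul (2 * i + 1 + 1) x" by (simp add: algebra_simps)
  then show ?case using step1 by (simp only: int_mul_Suc add.assoc[of x x])
next
  case (step2 i)
  have "int_mul (2 * (i - 1)) x = int_mul (2 * i - 1 - 1) x" by (simp add: algebra_simps)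
  then show ?case using step2 by (simp only: int_mul_pred add.assoc[of "- x" "- x"] minus_add)
qed simp

lemma int_mul_conj: "g + int_mul z x = int_mul z (g + x - g) + g"
proof (induction z rule: int_induct[where k = 0])
  case (step1 i)
  have "g + int_mul (i + 1) x = (g + x - g) + (g + int_mul i x)"
    by (simp add: int_mul_Suc group_simps del: add_uminus_conv_diff)
  also note step1(2)
  finally show ?case by (simp only: int_mul_Suc add.assoc)
next
  case (step2 i)
  have "g + int_mul (i - 1) x = - (g + x - g) + (g + int_mul i x)"
    unfolding int_mul_pred by (simp add: group_simps del: add_uminus_conv_diff)
  also note step2(2)
  finally show ?case by (simp add: int_mul_pred add.assoc)
qed simp

section \<open>The Baumslag--Solitar group as a semidirect product\<close>

definition dyadic :: "real \<Rightarrow> bool" where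
  "dyadic r \<longleftrightarrow> (\<exists>z::int. \<exists>d::nat. r * 2 ^ d = of_int z)"

lemma dyadic_of_int [simp]: "dyadic (of_int z)"
  unfolding dyadic_def by (intro exI[of _ z] exI[of _ 0]) simp

lemma dyadic_0 [simp]: "dyadic 0"
  using dyadic_of_int[of 0] by simp

lemma dyadic_add [intro]:
  assumes "dyadic r" "dyadic r'" shows "dyadic (r + r')"
proof -
  obtain z d z' d' where "r * 2 ^ d = of_int z" "r' * 2 ^ d' = of_int z'"
    using assms unfolding dyadic_def by blast
  moreover have "(r + r') * 2 ^ (d + d') = (r * 2 ^ d) * 2 ^ d' + (r' * 2 ^ d') * 2 ^ d"
    by (simp add: power_add algebra_simps)
  ultimately have "(r + r') * 2 ^ (d + d') = of_int (z * 2 ^ d' + z' * 2 ^ d)"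
    by simp
  then show ?thesis unfolding dyadic_def by blast
qed

lemma dyadic_minus [intro]: "dyadic r \<Longrightarrow> dyadic (- r)"
  unfolding dyadic_def by (metis minus_mult_left of_int_minus)

lemma dyadic_mult_powi [intro]:
  assumes "dyadic r" shows "dyadic (2 powi k * r)"
proof -
  obtain z d where z: "r * 2 ^ d = of_int z" using assms unfolding dyadic_def by blast
  show ?thesis
  proof (cases "k \<ge> 0")
    case True
    then have "2 powi k * r * 2 ^ d = of_int (2 ^ nat k * z)"
      using z by (simp add: power_int_def)
    then show ?thesis unfolding dyadic_def by blast
  next
    case False
    then have "2 powi k * r * 2 ^ (d + nat (- k)) = of_int z"
      using z by (simp add: power_int_def power_add field_simps)
    then show ?thesis unfolding dyadic_def by blast
  qed
qed

text \<open>The pair (r, k) stands for a^r s^k, that is, for the affine map sending x to r + 2^k x.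
  Real numbers carry the translation part so that absolute values and \<open>powi\<close> apply to
  it directly.\<close>

typedef bs = "{(r :: real, k :: int). dyadic r}"
  by (rule exI[of _ "(0, 0)"]) simp

setup_lifting type_definition_bs

lift_definition transl :: "bs \<Rightarrow> real" is fst .
lift_definition expo :: "bs \<Rightarrow> int" is snd .

lemma dyadic_transl [simp]: "dyadic (transl h)"
  by transfer auto

lemma bs_eqI: "transl h = transl h' \<Longrightarrow> expo h = expo h' \<Longrightarrow> h = h'"
  by transfer auto

lemma bs_eq_iff: "h = h' \<longleftrightarrow> transl h = transl h' \<and> expo h = expo h'"
  by (blast intro: bs_eqI)

instantiation bs :: group_add
begin

lift_definition zero_bs :: bs is "(0, 0)" by simp
lift_definition plus_bs :: "bs \<Rightarrow> bs \<Rightarrow> bs" is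
  "\<lambda>(r, k) (r', k'). (r + 2 powi k * r', k + k')"
  by auto
lift_definition uminus_bs :: "bs \<Rightarrow> bs" is
  "\<lambda>(r, k). (- (2 powi (- k) * r), - k)"
  by auto
definition minus_bs :: "bs \<Rightarrow> bs \<Rightarrow> bs" where "minus_bs x y = x + - y"

instance
proof
  fix x y z :: bs
  show "x + y + z = x + (y + z)"
    by transfer (auto simp: power_int_add algebra_simps)
  show "0 + x = x" "x + 0 = x" by (transfer; auto)+
  show "- x + x = 0" by transfer auto
  show "x + - y = x - y" by (simp add: minus_bs_def)
qed

end

lemma transl_add [simp]: "transl (x + y) = transl x + 2 powi expo x * transl y"
  by transfer auto
lemma expo_add [simp]: "expo (x + y) = expo x + expo y"
  by transfer auto
lemma transl_0 [simp]: "transl 0 = 0"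
  by transfer auto
lemma expo_0 [simp]: "expo 0 = 0"
  by transfer auto
lemma transl_minus [simp]: "transl (- x) = - (2 powi (- expo x) * transl x)"
  by transfer auto
lemma expo_minus [simp]: "expo (- x) = - expo x"
  by transfer auto

lift_definition bs_of :: "int \<Rightarrow> nat \<Rightarrow> int \<Rightarrow> bs" is "\<lambda>z d k. (of_int z / 2 ^ d, k)"
  by (simp add: dyadic_def) (metis nonzero_eq_divide_eq power_not_zero zero_neq_numeral)

lemma transl_bs_of [simp]: "transl (bs_of z d k) = of_int z / 2 ^ d"
  by transfer simp
lemma expo_bs_of [simp]: "expo (bs_of z d k) = k"
  by transfer simp

text \<open>The two associated subgroups: \<open>sub True\<close> is generated by \<open>s = tat\<^sup>-\<^sup>1\<close> and
  \<open>sub False\<close> by \<open>a\<close>, so that \<open>sub e j\<close> can be moved to the right across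
  \<open>t\<close> (for \<open>e = True\<close>) or \<open>t\<^sup>-\<^sup>1\<close>.\<close>

definition sub :: "bool \<Rightarrow> int \<Rightarrow> bs" where
  "sub e j = (if e then bs_of 0 0 j else bs_of j 0 0)"

lemma transl_sub [simp]: "transl (sub e j) = (if e then 0 else of_int j)"
  by (simp add: sub_def)
lemma expo_sub [simp]: "expo (sub e j) = (if e then j else 0)"
  by (simp add: sub_def)
lemma sub_add: "sub e (i + j) = sub e i + sub e j"
  by (rule bs_eqI) simp_all
lemma sub_0 [simp]: "sub e 0 = 0"
  by (rule bs_eqI) simp_all
lemma sub_minus: "sub e (- i) = - sub e i"
  by (rule bs_eqI) simp_all
section \<open>The Baumslag--Gersten group as a type\<close>

\<comment> \<open>A type copy of the presented group, written additively although it is not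
  commutative, so that the simplification rules of \<open>group_add\<close> apply. The way back is
  \<open>elt_length_bg\<close> and \<open>conjugators_bg_iff\<close>.\<close>
quotient_type bg = "bg_gen gword" / "pres_eq bg_relators"
proof (rule equivpI)
  show "reflp (pres_eq bg_relators)" by (auto simp: reflp_def intro: pres_refl)
  show "symp (pres_eq bg_relators)" by (auto simp: symp_def intro: pres_sym)
  show "transp (pres_eq bg_relators)" by (auto simp: transp_def intro: pres_trans)
qed

lemma inv_word_inv_word [simp]: "inv_word (inv_word w) = w"
  by (induction w) (auto simp: inv_word_def)

lemma length_inv_word [simp]: "length (inv_word w) = length w"
  by (simp add: inv_word_def)

lemma pres_eq_inv_word_cong:
  assumes "pres_eq R v w" shows "pres_eq R (inv_word v) (inv_word w)"
proof -
  have "pres_eq R (inv_word v @ [] @ []) (inv_word v @ (w @ inv_word w) @ [])"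
    using pres_eq_inv_word[of R "inv_word w"] by (intro pres_eq_append_ctxt) (auto intro: pres_sym)
  moreover have "pres_eq R (inv_word v @ w @ inv_word w) (inv_word v @ v @ inv_word w)"
    using assms by (intro pres_eq_append_ctxt) (rule pres_sym)
  moreover have "pres_eq R ([] @ (inv_word v @ v) @ inv_word w) ([] @ [] @ inv_word w)"
    by (intro pres_eq_append_ctxt pres_eq_inv_word)
  ultimately show ?thesis by (auto intro: pres_trans)
qed

instantiation bg :: group_add
begin

lift_definition zero_bg :: bg is "[]" .
lift_definition plus_bg :: "bg \<Rightarrow> bg \<Rightarrow> bg" is "(@)" by (rule pres_eq_append)
lift_definition uminus_bg :: "bg \<Rightarrow> bg" is inv_word by (rule pres_eq_inv_word_cong)
definition minus_bg :: "bg \<Rightarrow> bg \<Rightarrow> bg" where "minus_bg x y = x + - y"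

instance
proof
  fix x y z :: bg
  show "x + y + z = x + (y + z)" by transfer (simp add: pres_refl)
  show "0 + x = x" "x + 0 = x" by (transfer; simp add: pres_refl)+
  show "- x + x = 0" by transfer (rule pres_eq_inv_word)
  show "x + - y = x - y" by (simp add: minus_bg_def)
qed

end

lift_definition gen :: "bg_gen \<Rightarrow> bg" is "\<lambda>x. [(x, True)]" .

abbreviation ga :: bg where "ga \<equiv> gen Gen_a"
abbreviation gt :: bg where "gt \<equiv> gen Gen_t"
definition gs :: bg where "gs = gt + ga - gt"

definition letter :: "bg_gen \<times> bool \<Rightarrow> bg" where
  "letter l = (if snd l then gen (fst l) else - gen (fst l))"

lemma abs_bg_append: "abs_bg (v @ w) = abs_bg v + abs_bg w"
  by (simp add: plus_bg.abs_eq)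

lemma abs_bg_inv_word: "abs_bg (inv_word w) = - abs_bg w"
  by (simp add: uminus_bg.abs_eq)

lemma abs_bg_Nil [simp]: "abs_bg [] = 0"
  by (simp add: zero_bg_def)

lemma abs_bg_Cons: "abs_bg (l # w) = letter l + abs_bg w"
proof -
  obtain x b where l: "l = (x, b)" by (cases l)
  have "abs_bg [(x, False)] = - abs_bg [(x, True)]"
    by (simp add: abs_bg_inv_word[symmetric] inv_word_def)
  then have "abs_bg [l] = letter l"
    by (cases b) (simp_all add: letter_def l gen_def)
  then show ?thesis using abs_bg_append[of "[l]" w] by simp
qed

lemma bg_relation: "gs + ga - gs = ga + ga"
proof -
  let ?s = "bg_t @ bg_a @ inv_word bg_t"
  let ?r = "(?s @ bg_a @ inv_word ?s) @ inv_word (bg_a @ bg_a)"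
  have "?r \<in> bg_relators" by (simp add: bg_relators_def Let_def)
  then have "pres_eq bg_relators ?r []"
    using pres_relator[of ?r bg_relators "[]" "[]"] by simp
  then have "abs_bg ?r = 0" by (metis abs_bg_Nil bg.abs_eq_iff)
  moreover have "abs_bg ?s = gs"
    by (simp add: abs_bg_append abs_bg_inv_word abs_bg_Cons letter_def gs_def group_simps
        del: add_uminus_conv_diff append.simps)
  moreover have "abs_bg bg_a = ga" by (simp add: abs_bg_Cons letter_def)
  moreover have "abs_bg ?r = (abs_bg ?s + (abs_bg bg_a + - abs_bg ?s)) + - (abs_bg bg_a + abs_bg bg_a)"
    by (simp only: abs_bg_append[of "?s @ bg_a @ inv_word ?s"] abs_bg_append[of ?s "bg_a @ inv_word ?s"]
        abs_bg_append[of bg_a] abs_bg_inv_word)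
  ultimately have "(gs + (ga + - gs)) + - (ga + ga) = 0" by simp
  then have "gs + (ga + - gs) = ga + ga"
    by (simp only: flip: diff_conv_add_uminus) simp
  then show ?thesis by (simp add: add.assoc diff_conv_add_uminus del: add_uminus_conv_diff)
qed

lemma gs_int_mul_ga: "gs + int_mul z ga = int_mul (2 * z) ga + gs"
  using int_mul_conj[of gs z ga] by (simp add: bg_relation int_mul_double)

lemma gs_mul_int_mul_ga: "int_mul (int n) gs + int_mul z ga = int_mul (2 ^ n * z) ga + int_mul (int n) gs"
proof (induction n arbitrary: z)
  case (Suc n)
  have Sn: "int (Suc n) = int n + 1" by simp
  have "int_mul (int (Suc n)) gs + int_mul z ga = gs + (int_mul (int n) gs + int_mul z ga)"
    by (simp only: Sn int_mul_Suc add.assoc)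
  also have "\<dots> = (gs + int_mul (2 ^ n * z) ga) + int_mul (int n) gs"
    by (simp only: Suc add.assoc)
  also have "\<dots> = int_mul (2 * (2 ^ n * z)) ga + (gs + int_mul (int n) gs)"
    by (simp only: gs_int_mul_ga add.assoc)
  finally show ?case by (simp only: Sn int_mul_Suc power_Suc mult.assoc)
qed simp

section \<open>Dyadic powers of a and the homomorphism from the Baumslag-Solitar group\<close>

definition dyadic_elt :: "int \<Rightarrow> nat \<Rightarrow> bg" where
  "dyadic_elt z d = - int_mul (int d) gs + int_mul z ga + int_mul (int d) gs"

lemma dyadic_elt_expand: "dyadic_elt (2 ^ e * z) (d + e) = dyadic_elt z d"
proof -
  have "int_mul (2 ^ e * z) ga = int_mul (int e) gs + int_mul z ga - int_mul (int e) gs"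
    by (simp add: gs_mul_int_mul_ga)
  moreover have "int_mul (int (d + e)) gs = int_mul (int e) gs + int_mul (int d) gs"
    by (simp flip: int_mul_add add: add.commute)
  ultimately show ?thesis
    by (simp add: dyadic_elt_def group_simps del: add_uminus_conv_diff)
qed

lemma dyadic_elt_eqI:
  assumes "(of_int z :: real) / 2 ^ d = of_int z' / 2 ^ d'"
  shows "dyadic_elt z d = dyadic_elt z' d'"
proof -
  have "(of_int (2 ^ d' * z) :: real) = of_int (2 ^ d * z')"
    using assms by (simp add: field_simps)
  then have "2 ^ d' * z = 2 ^ d * z'" by (simp only: of_int_eq_iff)
  then show ?thesis
    using dyadic_elt_expand[of d' z d] dyadic_elt_expand[of d z' d'] by (simp add: add.commute)
qed

text \<open>The power a^r for dyadic r. The description is unique because the value of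
  \<open>dyadic_elt\<close> depends only on the fraction, by \<open>dyadic_elt_eqI\<close>.\<close>

definition transl_elt :: "real \<Rightarrow> bg" where
  "transl_elt r = (THE g. \<exists>z d. r = of_int z / 2 ^ d \<and> g = dyadic_elt z d)"

lemma transl_elt_eq: "transl_elt (of_int z / 2 ^ d) = dyadic_elt z d"
  unfolding transl_elt_def by (rule the_equality) (auto intro: dyadic_elt_eqI)

lemma dyadic_elt_add: "dyadic_elt z d + dyadic_elt z' d = dyadic_elt (z + z') d"
  by (simp add: dyadic_elt_def int_mul_add group_simps del: add_uminus_conv_diff)

lemma dyadicE:
  assumes "dyadic r" obtains z d where "r = of_int z / 2 ^ d"
  using assms unfolding dyadic_def by (metis eq_divide_eq power_not_zero zero_neq_numeral)

lemma transl_elt_add: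
  assumes "dyadic r" "dyadic r'" shows "transl_elt (r + r') = transl_elt r + transl_elt r'"
proof -
  obtain z d where r: "r = of_int z / 2 ^ d" using assms(1) by (rule dyadicE)
  obtain z' d' where r': "r' = of_int z' / 2 ^ d'" using assms(2) by (rule dyadicE)
  have 1: "r = of_int (2 ^ d' * z) / 2 ^ (d + d')" by (simp add: r power_add)
  have 2: "r' = of_int (2 ^ d * z') / 2 ^ (d + d')" by (simp add: r' power_add)
  have 3: "r + r' = of_int (2 ^ d' * z + 2 ^ d * z') / 2 ^ (d + d')"
    unfolding 1 2 by (simp add: add_divide_distrib)
  have 4: "transl_elt r = dyadic_elt (2 ^ d' * z) (d + d')"
    unfolding 1 by (rule transl_elt_eq)
  have 5: "transl_elt r' = dyadic_elt (2 ^ d * z') (d + d')"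
    unfolding 2 by (rule transl_elt_eq)
  show ?thesis
    unfolding 4 5 dyadic_elt_add unfolding 3 by (rule transl_elt_eq)
qed

lemma gs_mul_transl_elt_nat:
  assumes "dyadic r"
  shows "int_mul (int n) gs + transl_elt r = transl_elt (2 ^ n * r) + int_mul (int n) gs"
proof -
  obtain z d where r: "r = of_int z / 2 ^ d" using assms by (rule dyadicE)
  have r2: "2 ^ n * r = of_int (2 ^ n * z) / 2 ^ d" by (simp add: r)
  have "int_mul (int n) gs - int_mul (int d) gs = - int_mul (int d) gs + int_mul (int n) gs"
    by (simp flip: int_mul_minus int_mul_add add: group_simps del: add_uminus_conv_diff)
  then have "int_mul (int n) gs + dyadic_elt z d
     = - int_mul (int d) gs + (int_mul (int n) gs + int_mul z ga) + int_mul (int d) gs"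
    by (simp only: dyadic_elt_def add.assoc[symmetric] diff_conv_add_uminus)
  also have "\<dots> = - int_mul (int d) gs + int_mul (2 ^ n * z) ga + (int_mul (int n) gs + int_mul (int d) gs)"
    by (simp only: gs_mul_int_mul_ga add.assoc)
  also have "int_mul (int n) gs + int_mul (int d) gs = int_mul (int d) gs + int_mul (int n) gs"
    by (simp flip: int_mul_add add: add.commute)
  finally show ?thesis
    unfolding r2 transl_elt_eq unfolding r transl_elt_eq by (simp add: dyadic_elt_def add.assoc)
qed

lemma gs_mul_transl_elt:
  assumes "dyadic r"
  shows "int_mul k gs + transl_elt r = transl_elt (2 powi k * r) + int_mul k gs"
proof (cases "k \<ge> 0")
  case True
  then show ?thesis using gs_mul_transl_elt_nat[OF assms, of "nat k"] by (simp add: power_int_def)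
next
  case False
  define n where "n = nat (- k)"
  have k: "k = - int n" using False by (simp add: n_def)
  have "int_mul (int n) gs + transl_elt (2 powi k * r) = transl_elt r + int_mul (int n) gs"
    using gs_mul_transl_elt_nat[of "2 powi k * r" n] assms
    using dyadic_mult_powi[OF assms, of k] by (simp add: k power_int_minus field_simps)
  then have "transl_elt (2 powi k * r) = - int_mul (int n) gs + transl_elt r + int_mul (int n) gs"
    by (metis add.assoc minus_add_cancel)
  then show ?thesis by (simp add: k int_mul_minus group_simps del: add_uminus_conv_diff)
qed

definition emb :: "bs \<Rightarrow> bg" where
  "emb h = transl_elt (transl h) + int_mul (expo h) gs"

lemma emb_add: "emb (h + h') = emb h + emb h'"
proof -
  have "emb h + emb h' = transl_elt (transl h) + (int_mul (expo h) gs + transl_elt (transl h')) + int_mul (expo h') gs"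
    by (simp add: emb_def add.assoc)
  also have "\<dots> = (transl_elt (transl h) + transl_elt (2 powi expo h * transl h')) + (int_mul (expo h) gs + int_mul (expo h') gs)"
    by (simp only: gs_mul_transl_elt[OF dyadic_transl] add.assoc)
  also have "\<dots> = transl_elt (transl h + 2 powi expo h * transl h') + int_mul (expo h + expo h') gs"
    by (simp add: transl_elt_add dyadic_mult_powi int_mul_add)
  finally show ?thesis by (simp add: emb_def)
qed

lemma emb_0 [simp]: "emb 0 = 0"
  using emb_add[of 0 0] by (metis add.right_neutral add_left_cancel)

lemma emb_minus: "emb (- h) = - emb h"
  using emb_add[of "- h" h] by (simp add: eq_neg_iff_add_eq_0)

lemma emb_sub: "emb (sub e j) = int_mul j (if e then gs else ga)"
proof -
  have "transl_elt (of_int j) = int_mul j ga" for j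
    using transl_elt_eq[of j 0] by (simp add: dyadic_elt_def)
  from this[of j] this[of 0] show ?thesis by (simp add: emb_def)
qed

lemma emb_bs_of: "emb (bs_of z d k) = dyadic_elt z d + int_mul k gs"
  by (simp add: emb_def transl_elt_eq)

definition stable_letter :: "bool \<Rightarrow> bg" where
  "stable_letter e = (if e then gt else - gt)"

lemma stable_Not: "stable_letter (\<not> e) = - stable_letter e"
  by (simp add: stable_letter_def)

text \<open>The edge relation s^j t = t a^j, stated for both signs of the stable letter at once.
  Each Britton reduction below is an application of it.\<close>

lemma emb_sub_stable: "emb (sub e j) + stable_letter e = stable_letter e + emb (sub (\<not> e) j)"
proof -
  have *: "gt + int_mul j ga = int_mul j gs + gt"
    using int_mul_conj[of gt j ga] by (simp add: gs_def)
  show ?thesis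
  proof (cases e)
    case True
    then show ?thesis using * by (simp add: emb_sub stable_letter_def)
  next
    case False
    have "int_mul j ga = - gt + (int_mul j gs + gt)" by (simp add: * [symmetric] del: add_uminus_conv_diff)
    then show ?thesis using False
      by (simp add: emb_sub stable_letter_def group_simps del: add_uminus_conv_diff)
  qed
qed

section \<open>Normal forms in the HNN extension\<close>

text \<open>\<open>Syl x e n\<close> stands for \<open>x t\<^sup>\<plusminus>\<^sup>1 n\<close>. In a valid normal form \<open>x\<close> is the chosen representative
  of its left coset of \<open>sub e\<close>, which is expressed by \<open>coset e x = 0\<close>.\<close>

datatype nf = End bs | Syl bs bool nf

text \<open>The integer j for which \<open>h\<close> is its coset representative times
  \<open>sub e j\<close>. Right multiplication by s^j shifts the exponent by j, and right
  multiplication by a^j shifts the quotient under the floor by j.\<close>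

definition coset :: "bool \<Rightarrow> bs \<Rightarrow> int" where
  "coset e h = (if e then expo h else \<lfloor>transl h / 2 powi expo h\<rfloor>)"

lemma coset_add_sub [simp]: "coset e (h + sub e j) = coset e h + j"
proof (cases e)
  case False
  have "(transl h + 2 powi expo h * of_int j) / 2 powi expo h = transl h / 2 powi expo h + of_int j"
    by (simp add: field_simps)
  then show ?thesis using False by (simp add: coset_def)
qed (simp add: coset_def)

lemma coset_0 [simp]: "coset e 0 = 0"
  by (simp add: coset_def)

lemma coset_sub [simp]: "coset e (sub e j) = j"
  using coset_add_sub[of e 0 j] by simp

definition coset_rep :: "bool \<Rightarrow> bs \<Rightarrow> bs" where
  "coset_rep e h = h + sub e (- coset e h)"

lemma coset_coset_rep [simp]: "coset e (coset_rep e h) = 0"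
  by (simp add: coset_rep_def)

lemma coset_rep_sub [simp]: "coset_rep e (sub e j) = 0"
  by (simp add: coset_rep_def flip: sub_add)

lemma coset_rep_add_sub: "coset_rep e (h + sub e j) = coset_rep e h"
proof -
  have "sub e j + sub e (- (coset e h + j)) = sub e (- coset e h)" by (simp flip: sub_add)
  then show ?thesis unfolding coset_rep_def coset_add_sub by (simp only: add.assoc)
qed

lemma coset_rep_id: "coset e h = 0 \<Longrightarrow> coset_rep e h = h"
  by (simp add: coset_rep_def)

lemma coset_rep_expand: "h = coset_rep e h + sub e (coset e h)"
  by (simp add: coset_rep_def add.assoc flip: sub_add)

lemma coset_rep_eq_0_iff: "coset_rep e h = 0 \<longleftrightarrow> h \<in> range (sub e)"
  using coset_rep_expand[of h e] by auto

text \<open>Left multiplication by \<open>h\<close>, renormalised: the part of \<open>h + x\<close>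
  in \<open>sub e\<close> crosses the letter t, where it becomes an element of
  \<open>sub (\<not> e)\<close>, and is passed on to the tail.\<close>

fun act :: "bs \<Rightarrow> nf \<Rightarrow> nf" where
  "act h (End k) = End (h + k)"
| "act h (Syl x e n) = Syl (coset_rep e (h + x)) e (act (sub (\<not> e) (coset e (h + x))) n)"

definition pinch :: "bool \<Rightarrow> nf \<Rightarrow> bool" where
  "pinch e n \<longleftrightarrow> (\<exists>n'. n = Syl 0 (\<not> e) n')"

definition push :: "bool \<Rightarrow> nf \<Rightarrow> nf" where
  "push e n = (if pinch e n then (case n of Syl x e' n' \<Rightarrow> n' | End k \<Rightarrow> End k) else Syl 0 e n)"

fun valid :: "nf \<Rightarrow> bool" where
  "valid (End k) \<longleftrightarrow> True"
| "valid (Syl x e n) \<longleftrightarrow> coset e x = 0 \<and> valid n \<and> \<not> pinch e n"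

lemma push_pinch [simp]: "push e (Syl 0 (\<not> e) n) = n"
  by (simp add: push_def pinch_def)

lemma push_Syl: "\<not> pinch e n \<Longrightarrow> push e n = Syl 0 e n"
  by (simp add: push_def)

text \<open>A pinch means that the first syllable lies in the trivial coset of
  \<open>sub (\<not> e)\<close>, and left multiplication by an element of that subgroup neither
  enters nor leaves this coset.\<close>

lemma pinch_act: "valid n \<Longrightarrow> pinch e (act (sub (\<not> e) j) n) \<longleftrightarrow> pinch e n"
proof (cases n)
  case (Syl x e' n')
  assume v: "valid n"
  show ?thesis
  proof (cases "e' = (\<not> e)")
    case True
    have "coset_rep e' (sub e' j + x) = 0 \<longleftrightarrow> x = 0"
    proof
      assume "coset_rep e' (sub e' j + x) = 0"
      then obtain i where "sub e' j + x = sub e' i" by (auto simp: coset_rep_eq_0_iff)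
      then have "x = sub e' (- j + i)" by (metis minus_add_cancel sub_add sub_minus)
      with v Syl show "x = 0" by simp
    qed simp
    then show ?thesis using True Syl by (simp add: pinch_def)
  qed (auto simp: pinch_def Syl)
qed (simp add: pinch_def)

lemma valid_act: "valid n \<Longrightarrow> valid (act h n)"
  by (induction n arbitrary: h) (simp_all add: pinch_act)

lemma act_0: "valid n \<Longrightarrow> act 0 n = n"
  by (induction n) (simp_all add: coset_rep_id)

lemma act_act: "act h (act h' n) = act (h + h') n"
proof (induction n arbitrary: h h')
  case (Syl x e n)
  let ?c = "coset e (h' + x)"
  have 1: "h + coset_rep e (h' + x) = (h + h' + x) + sub e (- ?c)"
    by (simp add: coset_rep_def add.assoc)
  have 2: "coset_rep e (h + coset_rep e (h' + x)) = coset_rep e (h + h' + x)"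
    unfolding 1 by (rule coset_rep_add_sub)
  have "coset e (h + coset_rep e (h' + x)) = coset e (h + h' + x) - ?c"
    unfolding 1 by simp
  then show ?case by (simp add: Syl 2 flip: sub_add)
qed (simp add: add.assoc)

lemma valid_push: "valid n \<Longrightarrow> valid (push e n)"
  by (cases n) (auto simp: push_def pinch_def)

lemma push_push: "valid n \<Longrightarrow> push e (push (\<not> e) n) = n"
proof (cases "pinch (\<not> e) n")
  case True
  assume v: "valid n"
  obtain n' where n: "n = Syl 0 e n'" using True by (auto simp: pinch_def)
  then have "push (\<not> e) n = n'" using push_pinch[of "\<not> e" n'] by simp
  moreover have "push e n' = Syl 0 e n'" using v n by (intro push_Syl) simp
  ultimately show ?thesis using n by simp
qed (simp add: push_Syl)

lemma act_push:
  assumes "valid n" shows "act (sub e j) (push e n) = push e (act (sub (\<not> e) j) n)"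
proof (cases "pinch e n")
  case True
  then show ?thesis by (auto simp: pinch_def)
next
  case False
  then show ?thesis using assms by (simp add: push_Syl pinch_act)
qed

section \<open>The action of the group on normal forms (van der Waerden's method)\<close>

definition letter_act :: "bg_gen \<times> bool \<Rightarrow> nf \<Rightarrow> nf" where
  "letter_act l = (case fst l of
      Gen_a \<Rightarrow> act (sub False (if snd l then 1 else - 1)) | Gen_t \<Rightarrow> push (snd l))"

definition word_act :: "bg_gen gword \<Rightarrow> nf \<Rightarrow> nf" where
  "word_act w = foldr letter_act w"

lemma word_act_append: "word_act (v @ w) n = word_act v (word_act w n)"
  by (simp add: word_act_def)

lemma valid_word_act: "valid n \<Longrightarrow> valid (word_act w n)"
  by (induction w) (auto simp: word_act_def letter_act_def valid_act valid_push split: bg_gen.split)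

lemma letter_act_cancel: "valid n \<Longrightarrow> letter_act (x, b) (letter_act (x, \<not> b) n) = n"
  by (cases x; cases b)
    (use push_push[of n True] push_push[of n False] in \<open>auto simp: letter_act_def act_act act_0 simp flip: sub_add split: bg_gen.split\<close>)

text \<open>Conjugating the action of a^j by that of t gives the action of
  \<open>sub True j\<close>. After this replacement the relator acts as one product in the
  Baumslag-Solitar group, and this product is 0.\<close>

lemma word_act_relator:
  assumes "valid n" "r \<in> bg_relators" shows "word_act r n = n"
proof -
  have conj: "push True (act (sub False j) (push False m)) = act (sub True j) m" if "valid m" for j m
    using act_push[of "push False m" True j] push_push[of m True] that by (simp add: valid_push)
  let ?a = "act (sub False 1)" and ?i = "act (sub False (- 1))"
  have r: "r = [(Gen_t, True), (Gen_a, True), (Gen_t, False), (Gen_a, True),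
      (Gen_t, True), (Gen_a, False), (Gen_t, False), (Gen_a, False), (Gen_a, False)]"
    using assms(2) by (simp add: bg_relators_def Let_def inv_word_def)
  have "word_act r n = push True (?a (push False (?a (push True (?i (push False (?i (?i n))))))))"
    by (simp add: r word_act_def letter_act_def)
  also have "\<dots> = act (sub True 1) (?a (act (sub True (- 1)) (?i (?i n))))"
    using assms(1) by (simp add: conj valid_act)
  also have "\<dots> = act (sub True 1 + (sub False 1 + (sub True (- 1) + (sub False (- 1) + sub False (- 1))))) n"
    by (simp add: act_act)
  also have "sub True 1 + (sub False 1 + (sub True (- 1) + (sub False (- 1) + sub False (- 1)))) = 0"
    by (rule bs_eqI) (simp_all add: power_int_minus)
  finally show ?thesis using assms(1) by (simp add: act_0)
qed

lemma word_act_cong: "pres_eq bg_relators v w \<Longrightarrow> valid n \<Longrightarrow> word_act v n = word_act w n"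
proof (induction arbitrary: n rule: pres_eq.induct)
  case (pres_cancel u x b v)
  then show ?case
    using letter_act_cancel[of "word_act v n" x b] by (simp add: word_act_append valid_word_act)
      (simp add: word_act_def)
next
  case (pres_relator r u v)
  then show ?case by (simp add: word_act_append valid_word_act word_act_relator)
qed auto

text \<open>By \<open>word_act_cong\<close> the chosen representative is immaterial on valid normal
  forms; hence the hypotheses \<open>valid n\<close> in what follows.\<close>

definition bg_act :: "bg \<Rightarrow> nf \<Rightarrow> nf" where
  "bg_act g = word_act (rep_bg g)"

lemma bg_act_abs: "valid n \<Longrightarrow> bg_act (abs_bg w) n = word_act w n"
  unfolding bg_act_def
  by (rule word_act_cong) (simp_all add: Quotient3_rep_abs[OF Quotient3_bg] pres_refl)

lemma valid_bg_act: "valid n \<Longrightarrow> valid (bg_act g n)"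
  by (simp add: bg_act_def valid_word_act)

lemma abs_bg_cases: obtains w where "g = abs_bg w"
  using Quotient3_abs_rep[OF Quotient3_bg] by metis

lemma bg_act_add: "valid n \<Longrightarrow> bg_act (g + h) n = bg_act g (bg_act h n)"
proof -
  assume n: "valid n"
  obtain v w where "g = abs_bg v" "h = abs_bg w" by (metis abs_bg_cases)
  then show ?thesis using n
    by (simp flip: abs_bg_append add: bg_act_abs word_act_append valid_word_act)
qed

lemma bg_act_0: "valid n \<Longrightarrow> bg_act 0 n = n"
  using bg_act_abs[of n "[]"] by (simp add: word_act_def)

lemma bg_act_stable:
  assumes "valid n" shows "bg_act (stable_letter e) n = push e n"
proof -
  have "stable_letter e = abs_bg [(Gen_t, e)]" by (simp add: abs_bg_Cons letter_def stable_letter_def)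
  then show ?thesis using bg_act_abs[OF assms] by (simp add: word_act_def letter_act_def)
qed

definition acts_as :: "bg \<Rightarrow> bs \<Rightarrow> bool" where
  "acts_as g h \<longleftrightarrow> (\<forall>n. valid n \<longrightarrow> bg_act g n = act h n)"

lemma acts_as_add: "acts_as g h \<Longrightarrow> acts_as g' h' \<Longrightarrow> acts_as (g + g') (h + h')"
  by (simp add: acts_as_def bg_act_add act_act valid_act)

lemma acts_as_minus:
  assumes "acts_as g h" shows "acts_as (- g) (- h)"
  unfolding acts_as_def
proof (intro allI impI)
  fix n assume n: "valid n"
  have "act h (bg_act (- g) n) = n"
    using assms n bg_act_add[of n g "- g"] by (simp add: acts_as_def valid_bg_act bg_act_0)
  then have "act (- h) n = act (- h) (act h (bg_act (- g) n))" by simp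
  also have "\<dots> = bg_act (- g) n" using n by (simp add: act_act act_0 valid_bg_act)
  finally show "bg_act (- g) n = act (- h) n" ..
qed

lemma acts_as_int_mul: "acts_as (int_mul j (if e then gs else ga)) (sub e j)"
proof -
  have a: "acts_as ga (sub False 1)"
  proof -
    have "ga = abs_bg [(Gen_a, True)]" by (simp add: abs_bg_Cons letter_def)
    then show ?thesis by (simp add: acts_as_def bg_act_abs word_act_def letter_act_def)
  qed
  have s: "acts_as gs (sub True 1)"
    unfolding acts_as_def
  proof (intro allI impI)
    fix n assume n: "valid n"
    have gs: "gs = stable_letter True + (ga + stable_letter False)"
      by (simp add: gs_def stable_letter_def group_simps del: add_uminus_conv_diff)
    have "bg_act gs n = push True (act (sub False 1) (push False n))"
      using a n by (simp add: gs bg_act_add bg_act_stable valid_bg_act acts_as_def valid_push valid_act)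
    then show "bg_act gs n = act (sub True 1) n"
      using act_push[of "push False n" True 1] push_push[of n True] n by (simp add: valid_push)
  qed
  define x where "x = (if e then gs else ga)"
  have x: "acts_as x (sub e 1)" using a s by (simp add: x_def)
  have "acts_as (int_mul j x) (sub e j)"
  proof (induction j rule: int_induct[where k = 0])
    case base
    show ?case by (simp add: acts_as_def bg_act_0 act_0)
  next
    case (step1 i)
    then show ?case using acts_as_add[OF x step1(2)]
      by (simp add: int_mul_Suc flip: sub_add) (simp add: add.commute)
  next
    case (step2 i)
    then show ?case using acts_as_add[OF acts_as_minus[OF x] step2(2)]
      by (simp add: int_mul_pred flip: sub_add sub_minus)
  qed
  then show ?thesis by (simp add: x_def)
qed

lemma acts_as_emb: "acts_as (emb h) h"
proof -
  obtain z d where "transl h = of_int z / 2 ^ d" by (rule dyadicE[OF dyadic_transl])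
  then have h: "h = bs_of z d (expo h)" by (intro bs_eqI) simp_all
  have "acts_as (- int_mul (int d) gs + int_mul z ga + int_mul (int d) gs + int_mul (expo h) gs)
     (- sub True (int d) + sub False z + sub True (int d) + sub True (expo h))"
    using acts_as_int_mul[of _ True] acts_as_int_mul[of _ False]
    by (intro acts_as_add acts_as_minus) simp_all
  moreover have "- sub True (int d) + sub False z + sub True (int d) + sub True (expo h) = bs_of z d (expo h)"
    by (rule bs_eqI) (simp_all add: power_int_minus field_simps)
  moreover have "emb (bs_of z d (expo h)) = - int_mul (int d) gs + int_mul z ga + int_mul (int d) gs + int_mul (expo h) gs"
    by (simp add: emb_bs_of dyadic_elt_def)
  ultimately show ?thesis using h by simp
qed

text \<open>The action on \<open>End 0\<close> recovers \<open>h\<close>, because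
  \<open>emb h\<close> sends \<open>End 0\<close> to \<open>End h\<close>.\<close>

lemma emb_inj: assumes "emb h = emb h'" shows "h = h'"
proof -
  have "act h (End 0) = act h' (End 0)"
    using acts_as_emb[of h] acts_as_emb[of h'] assms by (metis acts_as_def valid.simps(1))
  then show ?thesis by simp
qed

section \<open>Reduced sequences\<close>

text \<open>The sequence \<open>[(e\<^sub>1, b\<^sub>1), \<dots>, (e\<^sub>m, b\<^sub>m)]\<close> stands for \<open>t\<^bsup>e\<^sub>1\<^esup> b\<^sub>1 \<cdots> t\<^bsup>e\<^sub>m\<^esup> b\<^sub>m\<close>.\<close>

type_synonym syls = "(bool \<times> bs) list"

fun seq_val :: "syls \<Rightarrow> bg" where
  "seq_val [] = 0"
| "seq_val ((e, b) # xs) = stable_letter e + emb b + seq_val xs"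

lemma seq_val_append: "seq_val (xs @ ys) = seq_val xs + seq_val ys"
  by (induction xs rule: seq_val.induct) (simp_all add: add.assoc)

definition no_pinch :: "bool \<times> bs \<Rightarrow> bool \<times> bs \<Rightarrow> bool" where
  "no_pinch x y \<longleftrightarrow> \<not> (fst y = (\<not> fst x) \<and> snd x \<in> range (sub (fst y)))"

abbreviation reduced :: "syls \<Rightarrow> bool" where
  "reduced \<equiv> successively no_pinch"

fun seq_nf :: "bs \<Rightarrow> syls \<Rightarrow> nf" where
  "seq_nf h [] = End h"
| "seq_nf h ((e, b) # xs) = act h (Syl 0 e (seq_nf b xs))"

text \<open>Britton's lemma: normalising a reduced sequence only moves subgroup elements to the
  right and never cancels a stable letter, so the letters t of the sequence can be read off the
  normal form of the element.\<close>

lemma seq_nf_reduced: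
  assumes "reduced xs"
  shows "valid (seq_nf h xs) \<and> bg_act (emb h + seq_val xs) (End 0) = seq_nf h xs"
  using assms
proof (induction h xs rule: seq_nf.induct)
  case (1 h)
  then show ?case using acts_as_emb[of h] by (simp add: acts_as_def)
next
  case (2 h e b xs)
  have IH: "valid (seq_nf b xs)" "bg_act (emb b + seq_val xs) (End 0) = seq_nf b xs"
    using 2 by (auto simp: successively_Cons)
  have np: "\<not> pinch e (seq_nf b xs)"
  proof (cases xs)
    case (Cons y ys)
    obtain e' b' where y: "y = (e', b')" by (cases y)
    have "no_pinch (e, b) (e', b')" using 2(2) Cons y by simp
    then show ?thesis using Cons y by (auto simp: pinch_def no_pinch_def coset_rep_eq_0_iff)
  qed (simp add: pinch_def)
  have v: "valid (Syl 0 e (seq_nf b xs))" using np IH by simp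
  have "bg_act (emb h + seq_val ((e, b) # xs)) (End 0)
    = bg_act (emb h) (bg_act (stable_letter e) (bg_act (emb b + seq_val xs) (End 0)))"
    by (simp add: bg_act_add add.assoc valid_bg_act)
  also have "\<dots> = act h (Syl 0 e (seq_nf b xs))"
    using acts_as_emb[of h] v IH np by (simp add: bg_act_stable push_Syl acts_as_def)
  finally show ?case using v by (simp only: seq_nf.simps valid_act simp_thms)
qed

text \<open>Equal elements have equal normal forms, so the first letters agree and \<open>h\<close>,
  \<open>h'\<close> share a left coset of \<open>sub e\<close>. The discrepancy \<open>j\<close>
  crosses t and corrects the next syllable, which allows iteration.\<close>

lemma reduced_eq_step:
  assumes "reduced xs" "reduced ys" "emb h + seq_val xs = emb h' + seq_val ys"
  obtains (Nil) "xs = []" "ys = []" "h = h'"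
  | (Cons) e b xs' b' ys' j where "xs = (e, b) # xs'" "ys = (e, b') # ys'" "h = h' + sub e j"
      "emb (sub (\<not> e) j + b) + seq_val xs' = emb b' + seq_val ys'"
proof -
  have eq: "seq_nf h xs = seq_nf h' ys"
    using seq_nf_reduced[OF assms(1), of h] seq_nf_reduced[OF assms(2), of h'] assms(3) by simp
  show thesis
  proof (cases xs)
    case Nil
    then have "ys = []" using eq by (cases ys) auto
    then show thesis using that(1) Nil eq by simp
  next
    case (Cons x xs')
    obtain e b where x: "x = (e, b)" by (cases x)
    obtain b' ys' where y: "ys = (e, b') # ys'" and rep: "coset_rep e h = coset_rep e h'"
      using eq Cons x by (cases ys) auto
    define j where "j = coset e h - coset e h'"
    have "h = coset_rep e h' + (sub e (coset e h') + sub e j)"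
      using coset_rep_expand[of h e] by (simp add: rep j_def flip: sub_add)
    then have h: "h = h' + sub e j"
      using coset_rep_expand[of h' e] by (simp add: add.assoc[symmetric])
    have "emb h' + (emb (sub e j) + stable_letter e) + emb b + seq_val xs'
      = emb h' + stable_letter e + emb b' + seq_val ys'"
      using assms(3) by (simp add: Cons x y h emb_add add.assoc)
    then have "emb (sub (\<not> e) j + b) + seq_val xs' = emb b' + seq_val ys'"
      by (simp add: emb_sub_stable emb_add add.assoc)
    then show thesis using that(2) Cons x y h by blast
  qed
qed

section \<open>Word length and cost\<close>

definition word_len :: "bg \<Rightarrow> nat" where
  "word_len g = (LEAST n. \<exists>w. abs_bg w = g \<and> length w = n)"

lemma word_len_abs: "word_len (abs_bg w) \<le> length w"
  unfolding word_len_def by (rule Least_le) blast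

lemma word_len_witness: obtains w where "abs_bg w = g" "length w = word_len g"
proof -
  have "\<exists>n w. abs_bg w = g \<and> length w = n" by (metis abs_bg_cases)
  then show thesis using LeastI_ex[of "\<lambda>n. \<exists>w. abs_bg w = g \<and> length w = n"] that
    unfolding word_len_def by blast
qed

lemma word_len_0 [simp]: "word_len 0 = 0"
  using word_len_abs[of "[]"] by simp

lemma word_len_add: "word_len (g + h) \<le> word_len g + word_len h"
proof -
  obtain v w where "abs_bg v = g" "length v = word_len g" "abs_bg w = h" "length w = word_len h"
    by (metis word_len_witness)
  then show ?thesis using word_len_abs[of "v @ w"] by (simp add: abs_bg_append)
qed

lemma word_len_add_le: "word_len g \<le> m \<Longrightarrow> word_len h \<le> n \<Longrightarrow> word_len (g + h) \<le> m + n"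
  using word_len_add[of g h] by linarith

lemma word_len_minus [simp]: "word_len (- g) = word_len g"
proof -
  have le: "word_len (- g) \<le> word_len g" for g
  proof -
    obtain w where "abs_bg w = g" "length w = word_len g" by (metis word_len_witness)
    then show ?thesis using word_len_abs[of "inv_word w"] by (simp add: abs_bg_inv_word)
  qed
  show ?thesis using le[of g] le[of "- g"] by simp
qed

lemma word_len_letter: "word_len (letter l) \<le> 1"
  using word_len_abs[of "[l]"] by (simp add: abs_bg_Cons)

lemma word_len_stable: "word_len (stable_letter e) \<le> 1"
  using word_len_letter[of "(Gen_t, e)"] unfolding letter_def stable_letter_def by (cases e) simp_all

lemma word_len_ga: "word_len ga \<le> 1"
  using word_len_letter[of "(Gen_a, True)"] by (simp add: letter_def)

lemma word_len_int_mul: "word_len (int_mul j g) \<le> nat \<bar>j\<bar> * word_len g"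
proof -
  have *: "word_len (nat_mul n g) \<le> n * word_len g" for n
    by (induction n) (use word_len_add_le in auto)
  show ?thesis
    using *[of "nat \<bar>j\<bar>"] by (cases "j \<ge> 0") (auto simp: int_mul_def)
qed

lemma word_len_ga_mul: "word_len (int_mul j ga) \<le> nat \<bar>j\<bar>"
  using word_len_int_mul[of j ga] mult_le_mono2[OF word_len_ga, of "nat \<bar>j\<bar>"] by linarith

lemma emb_sub_conj: "emb (sub e j) = stable_letter e + emb (sub (\<not> e) j) - stable_letter e"
  unfolding emb_sub_stable[symmetric] by (simp add: add.assoc)

lemma word_len_conj_stable: "word_len (stable_letter e + g - stable_letter e) \<le> word_len g + 2"
proof -
  have "word_len (stable_letter e + (g + - stable_letter e)) \<le> 1 + (word_len g + 1)"
    by (intro word_len_add_le) (use word_len_stable in simp_all)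
  then show ?thesis by (simp add: add.assoc diff_conv_add_uminus del: add_uminus_conv_diff)
qed

lemma word_len_gs_mul: "word_len (int_mul j gs) \<le> nat \<bar>j\<bar> + 2"
  using emb_sub_conj[of True j] word_len_conj_stable[of True "int_mul j ga"] word_len_ga_mul[of j]
  by (simp add: emb_sub)

lemma word_len_sub: "word_len (emb (sub e j)) \<le> nat \<bar>j\<bar> + 2"
  using word_len_ga_mul[of j] word_len_gs_mul[of j] by (simp add: emb_sub)

lemma word_len_bs_of: "word_len (emb (bs_of z d k)) \<le> nat \<bar>z\<bar> + 2 * d + nat \<bar>k\<bar> + 6"
proof -
  have "word_len (- int_mul (int d) gs + int_mul z ga + int_mul (int d) gs + int_mul k gs)
    \<le> (d + 2) + nat \<bar>z\<bar> + (d + 2) + (nat \<bar>k\<bar> + 2)"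
    using word_len_gs_mul[of "int d"] word_len_ga_mul[of z] word_len_gs_mul[of k]
    by (intro word_len_add_le) simp_all
  then show ?thesis by (simp add: emb_bs_of dyadic_elt_def)
qed

text \<open>\<open>cost n h\<close> says that \<open>h\<close> is represented by a word of length at most \<open>n\<close> all of whose
  letters \<open>t\<^sup>\<plusminus>\<^sup>1\<close> are removed by nested Britton reductions.\<close>

inductive cost :: "nat \<Rightarrow> bs \<Rightarrow> bool" where
  cost_0: "cost n 0"
| cost_gen: "cost 1 (sub False 1)"
| cost_inv_gen: "cost 1 (sub False (- 1))"
| cost_add: "cost m h \<Longrightarrow> cost n h' \<Longrightarrow> cost (m + n) (h + h')"
| cost_stable: "cost n (sub (\<not> e) j) \<Longrightarrow> cost (n + 2) (sub e j)"

lemma cost_mono: assumes "cost m h" "m \<le> n" shows "cost n h"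
  using cost_add[OF assms(1) cost_0[of "n - m"]] assms(2) by simp

lemma word_len_cost: "cost n h \<Longrightarrow> word_len (emb h) \<le> n"
proof (induction rule: cost.induct)
  case (cost_stable n e j)
  then show ?case
    using emb_sub_conj[of e j] word_len_conj_stable[of e "emb (sub (\<not> e) j)"] by simp
qed (use word_len_ga in \<open>auto simp: emb_add emb_sub word_len_add_le\<close>)

fun seq_cost :: "nat \<Rightarrow> syls \<Rightarrow> bool" where
  "seq_cost n [] \<longleftrightarrow> True"
| "seq_cost n ((e, b) # xs) \<longleftrightarrow> (\<exists>m k. cost m b \<and> seq_cost k xs \<and> m + k + 1 \<le> n)"

lemma seq_cost_mono: "seq_cost m xs \<Longrightarrow> m \<le> n \<Longrightarrow> seq_cost n xs"
  by (cases xs) (auto, meson order_trans)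

lemma seq_cost_append: "seq_cost n (xs @ ys) \<longleftrightarrow> (\<exists>m k. seq_cost m xs \<and> seq_cost k ys \<and> m + k \<le> n)"
proof (induction xs arbitrary: n)
  case Nil
  show ?case
  proof
    show "seq_cost n ([] @ ys) \<Longrightarrow> \<exists>m k. seq_cost m [] \<and> seq_cost k ys \<and> m + k \<le> n"
      by (intro exI[of _ 0] exI[of _ n]) simp
  qed (auto intro: seq_cost_mono)
next
  case (Cons x xs)
  obtain e b where x: "x = (e, b)" by (cases x)
  show ?case
  proof
    assume "seq_cost n ((x # xs) @ ys)"
    then obtain m k k1 k2 where "cost m b" "seq_cost k1 xs" "seq_cost k2 ys" "k1 + k2 \<le> k" "m + k + 1 \<le> n"
      by (auto simp: x Cons)
    then show "\<exists>m k. seq_cost m (x # xs) \<and> seq_cost k ys \<and> m + k \<le> n"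
      by (intro exI[of _ "m + k1 + 1"] exI[of _ k2]) (auto simp: x)
  next
    assume "\<exists>m k. seq_cost m (x # xs) \<and> seq_cost k ys \<and> m + k \<le> n"
    then obtain m k k1 k2 where "cost m b" "seq_cost k1 xs" "seq_cost k2 ys" "m + k1 + 1 \<le> k" "k + k2 \<le> n"
      by (auto simp: x)
    then have "m + (k1 + k2) + 1 \<le> n" "seq_cost (k1 + k2) (xs @ ys)" by (auto simp: Cons)
    then show "seq_cost n ((x # xs) @ ys)" using \<open>cost m b\<close> by (auto simp: x)
  qed
qed

lemma seq_cost_rotate: "seq_cost n (xs @ ys) \<Longrightarrow> seq_cost n (ys @ xs)"
  unfolding seq_cost_append by (metis add.commute)

lemma seq_cost_mem: "seq_cost n xs \<Longrightarrow> (e, b) \<in> set xs \<Longrightarrow> cost n b"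
proof (induction xs arbitrary: n)
  case (Cons x xs)
  obtain e' b' m k where "x = (e', b')" "cost m b'" "seq_cost k xs" "m + k + 1 \<le> n"
    using Cons.prems(1) by (cases x) auto
  then show ?case
    using Cons.IH[of k] Cons.prems(2) cost_mono[of m b' n] cost_mono[of k b n] by auto
qed simp

lemma length_seq_cost: "seq_cost n xs \<Longrightarrow> length xs \<le> n"
proof (induction xs arbitrary: n)
  case (Cons x xs)
  then show ?case by (cases x) fastforce
qed simp

lemma word_len_seq_cost: "seq_cost n xs \<Longrightarrow> word_len (seq_val xs) \<le> n"
proof (induction xs arbitrary: n)
  case (Cons x xs)
  obtain e b where x: "x = (e, b)" by (cases x)
  obtain m k where mk: "cost m b" "seq_cost k xs" "m + k + 1 \<le> n" using Cons.prems x by auto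
  then have "word_len (stable_letter e + emb b + seq_val xs) \<le> 1 + m + k"
    by (intro word_len_add_le word_len_stable word_len_cost Cons.IH)
  then show ?case using mk by (simp add: x)
qed simp

text \<open>Britton reduction of the word from its right end, within the budget of its length. When
  two stable letters cancel, the 2 in \<open>cost_stable\<close> is paid by these two letters: the
  new one and the one already charged in \<open>seq_cost\<close>.\<close>

lemma reduced_decomposition:
  obtains h xs c d where "abs_bg w = emb h + seq_val xs" "reduced xs" "cost c h" "seq_cost d xs"
    "c + d \<le> length w"
proof -
  have "\<exists>h xs c d. abs_bg w = emb h + seq_val xs \<and> reduced xs \<and> cost c h \<and> seq_cost d xs \<and> c + d \<le> length w"
  proof (induction w)
    case Nil
    have "abs_bg [] = emb 0 + seq_val []" by simp
    then show ?case using cost_0[of 0] by fastforce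
  next
    case (Cons l w)
    then obtain h xs c d where IH: "abs_bg w = emb h + seq_val xs" "reduced xs" "cost c h" "seq_cost d xs"
      "c + d \<le> length w" by blast
    obtain x e where l: "l = (x, e)" by (cases l)
    show ?case
    proof (cases x)
      case Gen_a
      define y where "y = sub False (if e then 1 else - 1)"
      have y: "letter l = emb y" by (simp add: l Gen_a letter_def y_def emb_sub)
      have c: "cost 1 y" unfolding y_def using cost_gen cost_inv_gen by simp
      have "abs_bg (l # w) = emb (y + h) + seq_val xs"
        by (simp add: abs_bg_Cons y IH emb_add add.assoc)
      then show ?thesis using IH cost_add[OF c IH(3)] by fastforce
    next
      case Gen_t
      have lt: "letter l = stable_letter e" by (simp add: l Gen_t letter_def stable_letter_def)
      show ?thesis
      proof (cases "\<exists>b xs' j. xs = (\<not> e, b) # xs' \<and> h = sub (\<not> e) j")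
        case True
        then obtain b xs' j where xs: "xs = (\<not> e, b) # xs'" and h: "h = sub (\<not> e) j" by blast
        obtain m k where mk: "cost m b" "seq_cost k xs'" "m + k + 1 \<le> d" using IH xs by auto
        have "abs_bg (l # w) = (stable_letter e + emb (sub (\<not> e) j)) + stable_letter (\<not> e) + emb b + seq_val xs'"
          by (simp add: abs_bg_Cons lt IH xs h add.assoc)
        also have "\<dots> = emb (sub e j + b) + seq_val xs'"
          by (simp add: emb_sub_stable[symmetric] stable_Not emb_add add.assoc)
        finally have eq: "abs_bg (l # w) = emb (sub e j + b) + seq_val xs'" .
        have "cost (c + 2 + m) (sub e j + b)"
          using IH(3) mk(1) unfolding h by (intro cost_add cost_stable)
        moreover have "reduced xs'" using IH(2) xs by (auto simp: successively_Cons)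
        moreover have "c + 2 + m + k \<le> length (l # w)" using IH(5) mk by simp
        ultimately show ?thesis using eq mk(2) by blast
      next
        case False
        have "abs_bg (l # w) = emb 0 + seq_val ((e, h) # xs)"
          by (simp add: abs_bg_Cons lt IH add.assoc)
        moreover have "reduced ((e, h) # xs)"
        proof (cases xs)
          case (Cons y ys)
          have "no_pinch (e, h) y"
          proof (rule ccontr)
            assume "\<not> no_pinch (e, h) y"
            then obtain b j where "y = (\<not> e, b)" "h = sub (\<not> e) j"
              unfolding no_pinch_def by (cases y) (simp, blast)
            then show False using False Cons by blast
          qed
          then show ?thesis using IH(2) Cons by simp
        qed simp
        moreover have "seq_cost (length (l # w)) ((e, h) # xs)" using IH by auto
        ultimately show ?thesis using cost_0[of 0] by fastforce
      qed
    qed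
  qed
  then show thesis using that by blast
qed

section \<open>Tower bounds for exponents\<close>

text \<open>A tower of height log_2 n + O(1), because unrolling halves the argument: an exponent
  that has to be raised and lowered again can use only half of the length. The factor
  \<open>n\<close> makes the function superadditive (\<open>growth_add\<close>), as products of
  elements require.\<close>

fun growth :: "nat \<Rightarrow> nat" where
  "growth n = (if n = 0 then 0 else n * 2 ^ growth (n div 2))"

declare growth.simps [simp del]

lemma growth_0 [simp]: "growth 0 = 0"
  by (simp add: growth.simps)

lemma growth_pos: "n > 0 \<Longrightarrow> growth n = n * 2 ^ growth (n div 2)"
  by (subst growth.simps) simp

lemma growth_mono: "m \<le> n \<Longrightarrow> growth m \<le> growth n"
proof (induction n arbitrary: m rule: less_induct)
  case (less n)
  show ?case
  proof (cases "m = 0")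
    case False
    then have "growth (m div 2) \<le> growth (n div 2)" using less by (intro less.IH) auto
    then have "m * 2 ^ growth (m div 2) \<le> n * 2 ^ growth (n div 2)"
      using less.prems by (intro mult_mono power_increasing) auto
    then show ?thesis using False less.prems by (simp add: growth_pos)
  qed simp
qed

lemma growth_add: "growth m + growth n \<le> growth (m + n)"
proof (cases "m = 0 \<or> n = 0")
  case False
  have "growth m + growth n = m * 2 ^ growth (m div 2) + n * 2 ^ growth (n div 2)"
    using False by (simp add: growth_pos)
  also have "\<dots> \<le> m * 2 ^ growth ((m + n) div 2) + n * 2 ^ growth ((m + n) div 2)"
    by (intro add_mono mult_left_mono power_increasing growth_mono div_le_mono) auto
  also have "\<dots> = growth (m + n)" using False by (simp add: growth_pos add_mult_distrib)
  finally show ?thesis .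
qed auto

text \<open>Meant for \<open>p\<close> the smaller of the raising and lowering budgets, so that 2 p
  + k is within the total. The exponents at \<open>k div 2\<close> and at \<open>p\<close> then add
  up to at most the one at \<open>n div 2\<close>.\<close>

lemma growth_mult_power: "2 * p + k \<le> n \<Longrightarrow> growth k * 2 ^ growth p \<le> growth n"
proof (cases "k = 0")
  case False
  assume le: "2 * p + k \<le> n"
  have "growth (k div 2) + growth p \<le> growth (n div 2)"
    using le by (intro order_trans[OF growth_add] growth_mono) linarith
  then have "k * 2 ^ (growth (k div 2) + growth p) \<le> n * 2 ^ growth (n div 2)"
    using le by (intro mult_mono power_increasing) auto
  then show ?thesis using le False by (simp add: growth_pos power_add mult.assoc)
qed simp

text \<open>Here \<open>p\<close> and \<open>q\<close> bound the lengths spent on raising and lowering the exponent, and \<open>k\<close> the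
  length spent on translations. An element of \<open>sub False\<close> has exponent 0, so that its translation
  part is controlled by the smaller one of \<open>p\<close> and \<open>q\<close>; this halving is what keeps the height of the
  tower down to the logarithm of the length.\<close>

lemma cost_bounds:
  assumes "cost n h"
  obtains p q k z where "p + q + k \<le> n"
    "\<bar>transl h\<bar> \<le> real (growth k) * 2 ^ growth p"
    "\<bar>transl h\<bar> * 2 powi (- expo h) \<le> real (growth k) * 2 ^ growth q"
    "- int (growth q) \<le> expo h" "expo h \<le> int (growth p)"
    "transl h * 2 ^ growth q = of_int z"
proof -
  have powi_le: "2 powi i \<le> (2 ^ m :: real)" if "i \<le> int m" for i :: int and m
    using that power_int_increasing[of i "int m" "2 :: real"] by simp
  have "\<exists>p q k. \<exists>z::int. p + q + k \<le> n \<and> \<bar>transl h\<bar> \<le> real (growth k) * 2 ^ growth p \<and>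
    \<bar>transl h\<bar> * 2 powi (- expo h) \<le> real (growth k) * 2 ^ growth q \<and>
    - int (growth q) \<le> expo h \<and> expo h \<le> int (growth p) \<and> transl h * 2 ^ growth q = of_int z"
    using assms
  proof (induction rule: cost.induct)
    case (cost_0 n)
    show ?case by (intro exI[of _ 0]) auto
  next
    case cost_gen
    show ?case by (intro exI[of _ 0] exI[of _ 0] exI[of _ 1] exI[of _ 1]) (simp add: growth.simps)
  next
    case cost_inv_gen
    show ?case by (intro exI[of _ 0] exI[of _ 0] exI[of _ 1] exI[of _ "- 1"]) (simp add: growth.simps)
  next
    case (cost_add m h n h')
    then obtain p q k p' q' k' and z z' :: int
      where 1: "p + q + k \<le> m" "\<bar>transl h\<bar> \<le> real (growth k) * 2 ^ growth p"
        "\<bar>transl h\<bar> * 2 powi (- expo h) \<le> real (growth k) * 2 ^ growth q"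
        "- int (growth q) \<le> expo h" "expo h \<le> int (growth p)" "transl h * 2 ^ growth q = of_int z"
      and 2: "p' + q' + k' \<le> n" "\<bar>transl h'\<bar> \<le> real (growth k') * 2 ^ growth p'"
        "\<bar>transl h'\<bar> * 2 powi (- expo h') \<le> real (growth k') * 2 ^ growth q'"
        "- int (growth q') \<le> expo h'" "expo h' \<le> int (growth p')" "transl h' * 2 ^ growth q' = of_int z'"
      by blast
    have grow: "(real (growth k) + real (growth k')) * 2 ^ (growth i + growth j)
        \<le> real (growth (k + k')) * 2 ^ growth (i + j)" for i j
      using growth_add[of k k'] growth_add[of i j] unfolding of_nat_mult of_nat_power of_nat_numeral
      by (intro mult_mono power_increasing) (simp_all flip: of_nat_add)
    have one_le: "1 \<le> (2::real) ^ i" for i by simp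
    have "\<bar>transl (h + h')\<bar> \<le> \<bar>transl h\<bar> + 2 powi expo h * \<bar>transl h'\<bar>"
      by (simp add: abs_triangle_ineq[THEN order_trans] abs_mult)
    also have "\<dots> \<le> real (growth k) * 2 ^ growth p * 2 ^ growth p' + 2 ^ growth p * (real (growth k') * 2 ^ growth p')"
    proof (intro add_mono)
      show "\<bar>transl h\<bar> \<le> real (growth k) * 2 ^ growth p * 2 ^ growth p'"
        using 1(2) mult_left_mono[OF one_le, of "real (growth k) * 2 ^ growth p" "growth p'"]
        by simp
    qed (use 1 2 in \<open>intro mult_mono powi_le; auto\<close>)
    also have "\<dots> = (real (growth k) + real (growth k')) * 2 ^ (growth p + growth p')"
      by (simp add: power_add algebra_simps)
    also note grow
    finally have A: "\<bar>transl (h + h')\<bar> \<le> real (growth (k + k')) * 2 ^ growth (p + p')" .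
    have "\<bar>transl (h + h')\<bar> * 2 powi (- expo (h + h')) \<le> (\<bar>transl h\<bar> + 2 powi expo h * \<bar>transl h'\<bar>) * 2 powi (- expo (h + h'))"
      by (intro mult_right_mono) (simp_all add: abs_triangle_ineq[THEN order_trans] abs_mult)
    also have "\<dots> = \<bar>transl h\<bar> * 2 powi (- expo h) * 2 powi (- expo h') + \<bar>transl h'\<bar> * 2 powi (- expo h')"
      by (simp add: power_int_add power_int_minus field_simps power_int_diff)
    also have "\<dots> \<le> real (growth k) * 2 ^ growth q * 2 ^ growth q' + 2 ^ growth q * (real (growth k') * 2 ^ growth q')"
    proof (intro add_mono)
      show "\<bar>transl h'\<bar> * 2 powi (- expo h') \<le> 2 ^ growth q * (real (growth k') * 2 ^ growth q')"
        using 2(3) mult_right_mono[OF one_le, of "real (growth k') * 2 ^ growth q'" "growth q"]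
        by simp
      show "\<bar>transl h\<bar> * 2 powi (- expo h) * 2 powi (- expo h') \<le> real (growth k) * 2 ^ growth q * 2 ^ growth q'"
        by (rule mult_mono) (use 1 2 in \<open>auto intro: powi_le\<close>)
    qed
    also have "\<dots> = (real (growth k) + real (growth k')) * 2 ^ (growth q + growth q')"
      by (simp add: power_add algebra_simps)
    also note grow
    finally have B: "\<bar>transl (h + h')\<bar> * 2 powi (- expo (h + h')) \<le> real (growth (k + k')) * 2 ^ growth (q + q')" .
    have C: "- int (growth (q + q')) \<le> expo (h + h')" "expo (h + h') \<le> int (growth (p + p'))"
      using 1 2 growth_add[of q q'] growth_add[of p p'] by simp_all
    define c where "c = growth (q + q') - (growth q + growth q')"
    have c: "growth (q + q') = growth q + growth q' + c" using growth_add[of q q'] by (simp add: c_def)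
    have e: "2 powi expo h * 2 ^ growth q = (2 ^ nat (expo h + int (growth q)) :: real)"
    proof -
      have "2 powi expo h * 2 ^ growth q = (2 powi (expo h + int (growth q)) :: real)"
        by (simp add: power_int_add)
      then show ?thesis using 1(4) by (simp add: power_int_def)
    qed
    have "transl (h + h') * 2 ^ growth (q + q')
      = (transl h * 2 ^ growth q) * 2 ^ growth q' * 2 ^ c
        + (2 powi expo h * 2 ^ growth q) * (transl h' * 2 ^ growth q') * 2 ^ c"
      unfolding c by (simp add: power_add algebra_simps)
    also have "\<dots> = of_int (z * 2 ^ growth q' * 2 ^ c + 2 ^ nat (expo h + int (growth q)) * z' * 2 ^ c)"
      unfolding 1(6) 2(6) e by simp
    finally have D: "transl (h + h') * 2 ^ growth (q + q')
      = of_int (z * 2 ^ growth q' * 2 ^ c + 2 ^ nat (expo h + int (growth q)) * z' * 2 ^ c)" .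
    have "p + p' + (q + q') + (k + k') \<le> m + n" using 1 2 by simp
    then show ?case using A B C D by blast
  next
    case (cost_stable n e j)
    then obtain p q k and z :: int where 1: "p + q + k \<le> n" "\<bar>transl (sub (\<not> e) j)\<bar> \<le> real (growth k) * 2 ^ growth p"
        "\<bar>transl (sub (\<not> e) j)\<bar> * 2 powi (- expo (sub (\<not> e) j)) \<le> real (growth k) * 2 ^ growth q"
        "- int (growth q) \<le> expo (sub (\<not> e) j)" "expo (sub (\<not> e) j) \<le> int (growth p)"
      by blast
    show ?case
    proof (cases e)
      case True
      have "\<bar>real_of_int j\<bar> \<le> real (growth k) * 2 ^ growth (min p q)"
        using 1 True by (cases "p \<le> q") (simp_all add: min_def)
      also have "\<dots> = real (growth k * 2 ^ growth (min p q))" by simp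
      also have "\<dots> \<le> growth n"
        using 1(1) by (intro of_nat_mono growth_mult_power) auto
      finally have j: "\<bar>j\<bar> \<le> int (growth n)" by linarith
      \<comment> \<open>A translation has become an exponent: by the sign of \<open>j\<close>, the
        whole length is booked as raising (\<open>p = n\<close>) or as lowering
        (\<open>q = n\<close>).\<close>
      show ?thesis
      proof (cases "j \<ge> 0")
        case True
        then show ?thesis using j \<open>e\<close> by (intro exI[of _ n] exI[of _ 0] exI[of _ 0] exI[of _ 0]) auto
      next
        case False
        then show ?thesis using j \<open>e\<close> by (intro exI[of _ 0] exI[of _ n] exI[of _ 0] exI[of _ 0]) auto
      qed
    next
      case False
      have "growth p \<le> growth n" "growth q \<le> growth n" using 1(1) by (auto intro: growth_mono)
      then have "\<bar>j\<bar> \<le> int (growth n)" using 1 False by auto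
      then show ?thesis using False
        by (intro exI[of _ 0] exI[of _ 0] exI[of _ n] exI[of _ j]) auto
    qed
  qed
  then show thesis using that by blast
qed

lemma cost_coarse_bounds:
  assumes "cost n h"
  shows "\<bar>transl h\<bar> \<le> 2 ^ (2 * growth n)" "\<bar>expo h\<bar> \<le> int (growth n)"
    "\<exists>z::int. transl h * 2 ^ growth n = of_int z"
proof -
  obtain p q k z where 1: "p + q + k \<le> n" "\<bar>transl h\<bar> \<le> real (growth k) * 2 ^ growth p"
    "- int (growth q) \<le> expo h" "expo h \<le> int (growth p)" "transl h * 2 ^ growth q = of_int z"
    using assms by (rule cost_bounds)
  have mono: "growth k \<le> growth n" "growth p \<le> growth n" "growth q \<le> growth n"
    using 1(1) by (auto intro: growth_mono)
  have "real (growth k) \<le> 2 ^ growth n"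
    using mono(1) less_exp[of "growth n"] by (metis less_imp_le of_nat_le_iff of_nat_numeral of_nat_power order_trans)
  then have "real (growth k) * 2 ^ growth p \<le> (2 ^ growth n * 2 ^ growth n :: real)"
    using mono by (intro mult_mono power_increasing) auto
  then show "\<bar>transl h\<bar> \<le> 2 ^ (2 * growth n)" using 1(2) by (simp add: mult_2 power_add)
  show "\<bar>expo h\<bar> \<le> int (growth n)" using 1 mono by auto
  have "growth n = growth q + (growth n - growth q)" using mono by simp
  then have "transl h * 2 ^ growth n = of_int (z * 2 ^ (growth n - growth q))"
    by (metis "1"(5) mult.assoc of_int_mult of_int_numeral of_int_power power_add)
  then show "\<exists>z::int. transl h * 2 ^ growth n = of_int z" by blast
qed

section \<open>Conjugator length in the Baumslag--Gersten group\<close>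

definition conj_by :: "bg \<Rightarrow> bg \<Rightarrow> bg \<Rightarrow> bool" where
  "conj_by g u v \<longleftrightarrow> g + u = v + g"

lemma word_elt_bg_eq_iff: "word_elt bg_relators v = word_elt bg_relators w \<longleftrightarrow> abs_bg v = abs_bg w"
  by (simp add: word_elt_eq_iff bg.abs_eq_iff)

lemma elt_length_bg: "elt_length bg_relators (word_elt bg_relators w) = word_len (abs_bg w)"
  by (simp add: elt_length_def word_len_def word_elt_bg_eq_iff)

lemma conjugators_bg_iff:
  "word_elt bg_relators w \<in> conjugators bg_relators u v \<longleftrightarrow> conj_by (abs_bg w) (abs_bg u) (abs_bg v)"
proof -
  interpret G: group "presented_group bg_relators" by (rule group_presented_group)
  let ?e = "word_elt bg_relators"
  have car: "?e x \<in> carrier (presented_group bg_relators)" for x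
    by (simp add: carrier_presented_group)
  have "?e w \<in> conjugators bg_relators u v \<longleftrightarrow>
    ?e w \<otimes>\<^bsub>presented_group bg_relators\<^esub> ?e u = ?e v \<otimes>\<^bsub>presented_group bg_relators\<^esub> ?e w"
    using car[of u] car[of v] car[of w]
    by (simp add: conjugators_def G.inv_solve_right')
  also have "\<dots> \<longleftrightarrow> conj_by (abs_bg w) (abs_bg u) (abs_bg v)"
    by (simp add: mult_presented_group word_elt_bg_eq_iff abs_bg_append conj_by_def)
  finally show ?thesis .
qed

lemma conjugators_cases:
  assumes "\<gamma> \<in> conjugators bg_relators u v" obtains w where "\<gamma> = word_elt bg_relators w"
  using assms by (auto simp: conjugators_def carrier_presented_group)

lemma conj_dist_le:
  assumes "conj_by g (abs_bg u) (abs_bg v)"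
  shows "conj_dist bg_relators u v \<le> word_len g"
proof -
  obtain w where "g = abs_bg w" by (rule abs_bg_cases)
  then show ?thesis
    unfolding conj_dist_def using assms
    by (intro Least_le bexI[of _ "word_elt bg_relators w"]) (simp_all add: elt_length_bg conjugators_bg_iff)
qed

lemma conj_dist_witness:
  assumes "conjugators bg_relators u v \<noteq> {}"
  obtains g where "conj_by g (abs_bg u) (abs_bg v)" "conj_dist bg_relators u v = word_len g"
proof -
  have "\<exists>n. \<exists>\<gamma>\<in>conjugators bg_relators u v. elt_length bg_relators \<gamma> = n" using assms by blast
  then have "\<exists>\<gamma>\<in>conjugators bg_relators u v. elt_length bg_relators \<gamma> = conj_dist bg_relators u v"
    unfolding conj_dist_def by (rule LeastI_ex)
  then obtain \<gamma> where \<gamma>: "\<gamma> \<in> conjugators bg_relators u v"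
    "elt_length bg_relators \<gamma> = conj_dist bg_relators u v" by blast
  obtain w where w: "\<gamma> = word_elt bg_relators w" using \<gamma>(1) by (rule conjugators_cases)
  show thesis using that[of "abs_bg w"] \<gamma> by (simp add: w conjugators_bg_iff elt_length_bg)
qed

lemma CL_bg_le:
  assumes "\<And>u v g. conj_by g u v \<Longrightarrow> word_len u + word_len v \<le> n \<Longrightarrow> \<exists>g'. conj_by g' u v \<and> word_len g' \<le> B"
  shows "CL bg_relators n \<le> B"
  unfolding CL_def
proof (rule Max.boundedI[OF finite_conj_dists conj_dists_nonempty])
  fix k assume "k \<in> conj_dists bg_relators n"
  then obtain u v where k: "k = conj_dist bg_relators u v" "conjugators bg_relators u v \<noteq> {}"
    "word_len (abs_bg u) + word_len (abs_bg v) \<le> n"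
    by (auto simp: conj_dists_def elt_length_bg)
  obtain g where "conj_by g (abs_bg u) (abs_bg v)" using k(2) by (rule conj_dist_witness)
  then obtain g' where "conj_by g' (abs_bg u) (abs_bg v)" "word_len g' \<le> B" using assms k(3) by blast
  then show "k \<le> B" using conj_dist_le[of g' u v] k(1) by simp
qed

lemma CL_bg_ge:
  assumes "conj_by g u v" "word_len u + word_len v \<le> n" "\<And>g'. conj_by g' u v \<Longrightarrow> B \<le> word_len g'"
  shows "B \<le> CL bg_relators n"
proof -
  obtain w x y where w: "g = abs_bg w" "u = abs_bg x" "v = abs_bg y" by (metis abs_bg_cases)
  have ne: "conjugators bg_relators x y \<noteq> {}" using assms(1) by (auto simp: w simp flip: conjugators_bg_iff)
  obtain g' where "conj_by g' u v" "conj_dist bg_relators x y = word_len g'"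
    using conj_dist_witness[OF ne] w by metis
  then have "B \<le> conj_dist bg_relators x y" using assms(3) by simp
  also have "conj_dist bg_relators x y \<in> conj_dists bg_relators n"
    using ne assms(2) unfolding conj_dists_def w by (auto simp: elt_length_bg)
  then have "conj_dist bg_relators x y \<le> CL bg_relators n"
    unfolding CL_def by (intro Max_ge finite_conj_dists)
  finally show ?thesis .
qed

lemma CL_bg_mono: "m \<le> n \<Longrightarrow> CL bg_relators m \<le> CL bg_relators n"
  unfolding CL_def
proof (intro Max_mono conj_dists_nonempty finite_conj_dists)
  show "conj_dists bg_relators m \<subseteq> conj_dists bg_relators n" if "m \<le> n"
    using that unfolding conj_dists_def by (blast intro: order_trans)
qed

section \<open>The lower bound\<close>

text \<open>The distance to the nearest integer.\<close>

definition frac_dist :: "real \<Rightarrow> real" where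
  "frac_dist x = \<bar>x - of_int (round x)\<bar>"

text \<open>Subadditive and at most 1 on powers of 2, hence a lower bound for the number of signed powers
  of 2 needed to write \<open>x\<close> as a sum.\<close>

definition dyadic_weight :: "nat \<Rightarrow> real \<Rightarrow> real" where
  "dyadic_weight N x = (\<Sum>i\<in>{1..N}. frac_dist (x / 2 ^ i))"

lemma frac_dist_le: "frac_dist x \<le> \<bar>x - of_int m\<bar>"
  using round_diff_minimal[of x m] by (simp add: frac_dist_def)

lemma frac_dist_add: "frac_dist (x + y) \<le> frac_dist x + frac_dist y"
  using frac_dist_le[of "x + y" "round x + round y"] by (simp add: frac_dist_def)

lemma dyadic_weight_add: "dyadic_weight N (x + y) \<le> dyadic_weight N x + dyadic_weight N y"
  unfolding dyadic_weight_def sum.distrib[symmetric]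
  by (intro sum_mono) (simp add: add_divide_distrib frac_dist_add)

lemma frac_dist_minus: "frac_dist (- x) = frac_dist x"
proof -
  have le: "frac_dist (- x) \<le> frac_dist x" for x
    using frac_dist_le[of "- x" "- round x"] by (simp add: frac_dist_def)
  show ?thesis using le[of x] le[of "- x"] by simp
qed

lemma dyadic_weight_minus [simp]: "dyadic_weight N (- x) = dyadic_weight N x"
  by (simp add: dyadic_weight_def frac_dist_minus)

lemma dyadic_weight_0 [simp]: "dyadic_weight N 0 = 0"
  by (simp add: dyadic_weight_def frac_dist_def)

text \<open>The terms with i <= c vanish and the others are at most 2^(c - i), a geometric series.
  The induction needs the sharper bound 1 - 2^(c - N) for the partial sums.\<close>

lemma dyadic_weight_power: "dyadic_weight N (2 powi c) \<le> 1"
proof -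
  have "dyadic_weight N (2 powi c) \<le> (if int N \<le> c then 0 else 1 - 2 powi (c - int N))"
  proof (induction N)
    case 0
    have "2 powi c \<le> (1::real)" if "c < 0" using that power_int_increasing[of c 0 "2::real"] by simp
    then show ?case by (simp add: dyadic_weight_def)
  next
    case (Suc N)
    have eq: "2 powi c / 2 ^ Suc N = (2 powi (c - int (Suc N)) :: real)"
      by (subst power_int_diff) (simp, simp only: power_int_of_nat)
    have step: "dyadic_weight (Suc N) (2 powi c) = dyadic_weight N (2 powi c) + frac_dist (2 powi (c - int (Suc N)))"
      unfolding eq[symmetric] by (simp add: dyadic_weight_def)
    show ?case
    proof (cases "int (Suc N) \<le> c")
      case True
      then have "(2 powi (c - int (Suc N)) :: real) = of_int (2 ^ nat (c - int (Suc N)))"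
        by (simp add: power_int_def)
      then have "frac_dist (2 powi (c - int (Suc N))) = 0" by (simp add: frac_dist_def del: of_int_power)
      then show ?thesis using Suc True by (simp add: step)
    next
      case False
      have "frac_dist (2 powi (c - int (Suc N))) \<le> 2 powi (c - int (Suc N))"
        using frac_dist_le[of "2 powi (c - int (Suc N))" 0] by simp
      moreover have "(2 powi (c - int N) :: real) = 2 * 2 powi (c - int (Suc N))"
        using power_int_add_1'[of "2::real" "c - int (Suc N)"] by simp
      moreover have "2 powi (c - int N) = (1::real)" if "int N \<le> c"
      proof -
        have "c = int N" using that False by simp
        then show ?thesis by simp
      qed
      ultimately show ?thesis using Suc False unfolding step by (auto split: if_splits)
    qed
  qed
  moreover have "(0::real) \<le> 2 powi (c - int N)" by simp
  ultimately show ?thesis by argo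
qed

text \<open>Each letter a adds one signed power of 2 to the translation. A product rescales
  translations by a power of 2, hence the claim for every \<open>c\<close>; crossing t exchanges
  translation and exponent, hence the second budget and the swap of \<open>p\<close> and
  \<open>q\<close> in the case \<open>cost_stable\<close>.\<close>

lemma cost_dyadic_weight:
  assumes "cost n h"
  shows "\<exists>p q. p + q \<le> n \<and> (\<forall>N c. dyadic_weight N (2 powi c * transl h) \<le> real p) \<and>
    (\<forall>N c. dyadic_weight N (2 powi c * of_int (expo h)) \<le> real q)"
  using assms
proof (induction rule: cost.induct)
  case (cost_0 n)
  show ?case by (intro exI[of _ 0]) simp
next
  case cost_gen
  show ?case by (intro exI[of _ 1] exI[of _ 0]) (simp add: dyadic_weight_power)
next
  case cost_inv_gen
  show ?case by (intro exI[of _ 1] exI[of _ 0]) (simp add: dyadic_weight_power)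
next
  case (cost_add m h n h')
  then obtain p q p' q' where 1: "p + q \<le> m" "p' + q' \<le> n"
    and 2: "\<And>N c. dyadic_weight N (2 powi c * transl h) \<le> real p"
      "\<And>N c. dyadic_weight N (2 powi c * of_int (expo h)) \<le> real q"
      "\<And>N c. dyadic_weight N (2 powi c * transl h') \<le> real p'"
      "\<And>N c. dyadic_weight N (2 powi c * of_int (expo h')) \<le> real q'" by blast
  have "dyadic_weight N (2 powi c * transl (h + h')) \<le> real (p + p')" for N c
  proof -
    have "2 powi c * transl (h + h') = 2 powi c * transl h + 2 powi (c + expo h) * transl h'"
      by (simp add: power_int_add algebra_simps)
    then show ?thesis
      using dyadic_weight_add[of N "2 powi c * transl h" "2 powi (c + expo h) * transl h'"] 2(1)[of N c]
        2(3)[of N "c + expo h"] by (simp del: transl_add)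
  qed
  moreover have "dyadic_weight N (2 powi c * of_int (expo (h + h'))) \<le> real (q + q')" for N c
    using dyadic_weight_add[of N "2 powi c * of_int (expo h)" "2 powi c * of_int (expo h')"] 2(2)[of N c]
      2(4)[of N c] by (simp add: distrib_left)
  ultimately show ?case using 1 by (intro exI[of _ "p + p'"] exI[of _ "q + q'"]) auto
next
  case (cost_stable n e j)
  then obtain p q where 1: "p + q \<le> n"
    and 2: "\<And>N c. dyadic_weight N (2 powi c * transl (sub (\<not> e) j)) \<le> real p"
      "\<And>N c. dyadic_weight N (2 powi c * of_int (expo (sub (\<not> e) j))) \<le> real q" by blast
  show ?case using 1 2 by (intro exI[of _ q] exI[of _ p]) auto
qed

lemma not_three_dvd_power_two: "\<not> (3::int) dvd 2 ^ m"
proof (induction m)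
  case (Suc m)
  then show ?case unfolding power_Suc by presburger
qed simp

text \<open>The number is 2^(2n - i)/3 - 1/(3 2^i). Its first term is at distance at least 1/3 from
  the integers, as 3 divides no power of 2, and its second term is at most 1/6.\<close>

lemma frac_dist_third:
  assumes "0 < i" "i \<le> 2 * n"
  shows "1 / 6 \<le> frac_dist ((4 ^ n - 1) / 3 / 2 ^ i)"
proof -
  define x :: real where "x = (4 ^ n - 1) / 3 / 2 ^ i"
  define w where "w = 2 ^ (2 * n - i) - 3 * round x"
  have "\<not> (3::int) dvd 2 ^ (2 * n - i)"
    by (rule not_three_dvd_power_two)
  moreover have "3 dvd 3 * round x" by simp
  ultimately have "w \<noteq> 0" unfolding w_def by (metis eq_iff_diff_eq_0)
  then have w: "\<bar>real_of_int w\<bar> \<ge> 1" by linarith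
  have "(4::real) ^ n = 2 ^ (2 * n)" by (simp add: power_mult)
  also have "\<dots> = 2 ^ i * 2 ^ (2 * n - i)" using assms(2) by (simp flip: power_add)
  finally have "3 * 2 ^ i * (x - round x) = 2 ^ i * of_int w - 1"
    by (simp add: x_def w_def field_simps)
  then have "3 * 2 ^ i * \<bar>x - round x\<bar> = \<bar>2 ^ i * of_int w - 1\<bar>"
    by (metis abs_mult abs_numeral power_abs)
  moreover have "2 ^ i \<le> \<bar>2 ^ i * real_of_int w\<bar>"
    using mult_left_mono[OF w, of "2 ^ i"] by (simp add: abs_mult)
  moreover have "(2::real) \<le> 2 ^ i" using power_increasing[of 1 i "2::real"] assms(1) by simp
  ultimately have "2 ^ i \<le> 2 * (3 * 2 ^ i * \<bar>x - round x\<bar>)"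
    by linarith
  then have "1 / 6 \<le> \<bar>x - round x\<bar>" by simp
  then show ?thesis by (simp only: frac_dist_def x_def)
qed

lemma dyadic_weight_third: "real n / 3 \<le> dyadic_weight (2 * n) ((4 ^ n - 1) / 3)"
proof -
  have "(\<Sum>i\<in>{1..2 * n}. 1 / 6 :: real) \<le> dyadic_weight (2 * n) ((4 ^ n - 1) / 3)"
    unfolding dyadic_weight_def by (intro sum_mono frac_dist_third) auto
  then show ?thesis by simp
qed

section \<open>Right multiplication of reduced sequences, and the pairs witnessing the lower
  bound\<close>

definition add_last :: "syls \<Rightarrow> bs \<Rightarrow> syls" where
  "add_last xs c = butlast xs @ [(fst (last xs), snd (last xs) + c)]"

lemma seq_val_add_last: "xs \<noteq> [] \<Longrightarrow> seq_val (add_last xs c) = seq_val xs + emb c"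
proof -
  assume "xs \<noteq> []"
  then obtain ys e b where "xs = ys @ [(e, b)]" by (metis rev_exhaust surj_pair)
  then show ?thesis by (simp add: add_last_def seq_val_append emb_add add.assoc)
qed

lemma length_add_last: "xs \<noteq> [] \<Longrightarrow> length (add_last xs c) = length xs"
  by (simp add: add_last_def)

text \<open>No stable letter follows the last syllable, so changing its group element cannot create
  a pinch.\<close>

lemma reduced_add_last: "xs \<noteq> [] \<Longrightarrow> reduced xs \<Longrightarrow> reduced (add_last xs c)"
proof -
  assume "xs \<noteq> []" "reduced xs"
  then obtain ys e b where "xs = ys @ [(e, b)]" "reduced (ys @ [(e, b)])" by (metis rev_exhaust surj_pair)
  then show ?thesis by (simp add: add_last_def successively_append_iff no_pinch_def)
qed

text \<open>The conjugators of \<open>s\<^sup>2\<close> to \<open>a\<^bsup>1-4^n\<^esup> s\<^sup>2\<close> all begin with the translation by \<open>(4\<^sup>n - 1) / 3\<close>.\<close>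

lemma conj_square_lower_bound:
  assumes "conj_by g (emb (sub True 2)) (emb v)" "transl v = 1 - 4 ^ n" "expo v = 2"
  shows "n \<le> 3 * word_len g"
proof -
  obtain w where w: "abs_bg w = g" "length w = word_len g" by (rule word_len_witness)
  obtain h xs c d where g: "abs_bg w = emb h + seq_val xs" "reduced xs" "cost c h" "seq_cost d xs"
    "c + d \<le> length w" by (rule reduced_decomposition)
  have "transl h = (4 ^ n - 1) / 3"
  proof (cases "xs = []")
    case True
    then have "emb (h + sub True 2) = emb (v + h)"
      using assms(1) g(1) w(1) by (simp add: conj_by_def emb_add)
    then have "h + sub True 2 = v + h" by (rule emb_inj)
    then show ?thesis using assms by (simp add: bs_eq_iff)
  next
    case False
    \<comment> \<open>Both sides are reduced, so \<open>v\<close> maps \<open>h\<close> into its own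
      coset of \<open>sub e\<close>. For \<open>e = False\<close> the exponents would differ by 2;
      for \<open>e = True\<close> the translations give (1 - 4^n) + 4 transl h = transl h.\<close>
    have "emb (v + h) + seq_val xs = emb h + seq_val (add_last xs (sub True 2))"
      using assms(1) g(1) w(1) False by (simp add: conj_by_def emb_add add.assoc seq_val_add_last)
    then obtain e j where "v + h = h + sub e j"
      using False reduced_eq_step[OF g(2) reduced_add_last[OF False g(2)]] by metis
    then show ?thesis using assms by (cases e) (simp_all add: bs_eq_iff)
  qed
  moreover obtain p q where "p + q \<le> c" "\<And>N i. dyadic_weight N (2 powi i * transl h) \<le> real p"
    using cost_dyadic_weight[OF g(3)] by blast
  ultimately have "real n / 3 \<le> real p" "p \<le> word_len g"
    using dyadic_weight_third[of n] g(5) w(2) by (metis mult_1 order_trans power_int_0_right, simp)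
  then show ?thesis by linarith
qed

text \<open>With m = iter_exp k 1, a^(2^m) = s^m a s^-m and s^m = t a^m t^-1, so one more level
  doubles the length and adds 5. The 5 on the left turns this into pure doubling.\<close>

lemma word_len_tower: "word_len (emb (sub False (int (iter_exp k 1)))) + 5 \<le> 6 * 2 ^ k"
proof (induction k)
  case 0
  then show ?case using word_len_ga_mul[of 1] by (simp add: emb_sub)
next
  case (Suc k)
  define m where "m = iter_exp k 1"
  have "sub False (2 ^ m) = sub True (int m) + sub False 1 + sub True (- int m)"
    by (rule bs_eqI) simp_all
  then have "emb (sub False (2 ^ m)) = emb (sub True (int m)) + emb (sub False 1) + - emb (sub True (int m))"
    by (simp only: emb_add emb_minus sub_minus)
  moreover have "word_len (emb (sub True (int m)) + emb (sub False 1) + - emb (sub True (int m)))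
      \<le> (word_len (emb (sub False (int m))) + 2) + 1 + (word_len (emb (sub False (int m))) + 2)"
  proof (intro word_len_add_le)
    show "word_len (emb (sub True (int m))) \<le> word_len (emb (sub False (int m))) + 2"
      unfolding emb_sub_conj[of True "int m"]
      using word_len_conj_stable[of True "emb (sub False (int m))"] by simp
    then show "word_len (- emb (sub True (int m))) \<le> word_len (emb (sub False (int m))) + 2" by simp
    show "word_len (emb (sub False 1)) \<le> 1" using word_len_ga by (simp add: emb_sub)
  qed
  ultimately show ?case using Suc by (simp add: m_def)
qed

text \<open>For k > 0 the tower m of height k is even, and with n = m/2 the number 4^n = 2^m is the
  next tower, so a^(4^n) has length O(2^k). The factor 6 is 2 from m = 2n times 3 from
  \<open>conj_square_lower_bound\<close>; the summand 1 covers k = 0.\<close>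

lemma CL_bg_lower: "iter_exp k 1 \<le> 6 * CL bg_relators (12 * 2 ^ k + 9) + 1"
proof (cases k)
  case (Suc k')
  define m where "m = iter_exp k 1"
  have "iter_exp k' 1 > 0" by (cases k') auto
  then have "even m" by (simp add: m_def Suc)
  then obtain n where n: "m = 2 * n" by blast
  have "(4::int) ^ n mod 3 = 1" by (simp add: power_mod flip: power_mod[of "4::int" 3 n])
  then obtain M :: int where M: "4 ^ n - 1 = 3 * M" using mod_eq_dvd_iff[of "4 ^ n" 3 1] by (auto elim: dvdE)
  have M': "(4::real) ^ n = 3 * of_int M + 1"
    using arg_cong[OF M, of "of_int :: int \<Rightarrow> real"] by simp
  define v where "v = bs_of (1 - 4 ^ n) 0 2"
  have v: "v = sub False 1 + sub False (- (2 ^ m)) + sub True 2"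
    by (rule bs_eqI) (simp_all add: v_def n power_mult)
  have s2: "word_len (emb (sub True 2)) \<le> 4"
    using word_len_sub[of True 2] by simp
  have "n \<le> 3 * CL bg_relators (12 * 2 ^ k + 9)"
  proof -
    \<comment> \<open>The quotient is n/3 rounded up, so that no loss occurs when returning to
      \<open>n\<close>.\<close>
    have "(n + 2) div 3 \<le> CL bg_relators (12 * 2 ^ k + 9)"
    proof (rule CL_bg_ge)
      have "sub False M + sub True 2 = v + sub False M"
        by (rule bs_eqI) (simp_all add: v_def M')
      then show "conj_by (emb (sub False M)) (emb (sub True 2)) (emb v)"
        by (simp add: conj_by_def flip: emb_add)
      have "word_len (emb (sub False 1) + - emb (sub False (2 ^ m)) + emb (sub True 2))
         \<le> 1 + (6 * 2 ^ Suc k - 5) + 4"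
        using word_len_ga word_len_tower[of "Suc k"] s2
        by (intro word_len_add_le) (simp_all add: emb_sub m_def)
      moreover have five: "1 + (6 * 2 ^ Suc k - 5) + 4 = (12 * 2 ^ k :: nat)"
      proof -
        have "(1::nat) \<le> 2 ^ k" by simp
        then show ?thesis unfolding power_Suc by arith
      qed
      ultimately have "word_len (emb v) \<le> 12 * 2 ^ k"
        unfolding v emb_add sub_minus emb_minus using five by simp
      then show "word_len (emb (sub True 2)) + word_len (emb v) \<le> 12 * 2 ^ k + 9"
        using s2 by simp
    next
      fix g assume "conj_by g (emb (sub True 2)) (emb v)"
      then have "n \<le> 3 * word_len g" by (rule conj_square_lower_bound) (simp_all add: v_def)
      then show "(n + 2) div 3 \<le> word_len g" by linarith
    qed
    then show ?thesis by linarith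
  qed
  then show ?thesis using n by (simp add: m_def)
qed simp

lemma tower_log_le_CL: "tower_log \<preceq> CL bg_relators"
  unfolding growth_le_def
proof (intro exI[of _ 12] conjI allI)
  fix n :: nat
  show "tower_log n \<le> 12 * CL bg_relators (12 * n + 12) + 12 * n + 12"
  proof (cases "n = 0")
    case False
    define k where "k = nat \<lfloor>log 2 (real n)\<rfloor>"
    have "real (2 ^ k) \<le> real n"
    proof -
      have "0 \<le> log 2 (real n)" using False by simp
      then have "real k \<le> log 2 (real n)" unfolding k_def by linarith
      then have "2 powr real k \<le> 2 powr (log 2 (real n))" by simp
      then show ?thesis using False by (simp add: powr_realpow)
    qed
    then have k: "2 ^ k \<le> n" by (simp only: of_nat_le_iff)
    have mono: "CL bg_relators (12 * 2 ^ k + 9) \<le> CL bg_relators (12 * n + 12)"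
      using k by (intro CL_bg_mono) simp
    have "tower_log n = iter_exp k 1" using False by (simp add: tower_log_def k_def)
    then show ?thesis using CL_bg_lower[of k] mono by linarith
  qed (simp add: tower_log_def)
qed simp

section \<open>Cyclic reduction\<close>

definition conj_within :: "nat \<Rightarrow> bg \<Rightarrow> bg \<Rightarrow> bool" where
  "conj_within k u v \<longleftrightarrow> (\<exists>g. conj_by g u v \<and> word_len g \<le> k)"

lemma conj_by_trans: "conj_by g u v \<Longrightarrow> conj_by h v w \<Longrightarrow> conj_by (h + g) u w"
proof -
  assume 1: "conj_by g u v" and 2: "conj_by h v w"
  have "h + g + u = h + (v + g)" using 1 by (simp only: conj_by_def add.assoc)
  also have "\<dots> = w + h + g" using 2 by (simp only: conj_by_def add.assoc[symmetric])
  finally show ?thesis by (simp only: conj_by_def add.assoc)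
qed

lemma conj_by_sym: "conj_by g u v \<Longrightarrow> conj_by (- g) v u"
proof -
  assume "conj_by g u v"
  then have "v = g + u + - g" by (simp add: conj_by_def add.assoc)
  then show ?thesis by (simp add: conj_by_def group_simps del: add_uminus_conv_diff)
qed

lemma conj_withinI: "conj_by g u v \<Longrightarrow> word_len g \<le> k \<Longrightarrow> conj_within k u v"
  by (auto simp: conj_within_def)

lemma conj_within_mono: "conj_within k u v \<Longrightarrow> k \<le> l \<Longrightarrow> conj_within l u v"
  by (auto simp: conj_within_def)

lemma conj_within_refl: "conj_within k u u"
  by (rule conj_withinI[of 0]) (simp_all add: conj_by_def)

lemma conj_within_trans: "conj_within k u v \<Longrightarrow> conj_within l v w \<Longrightarrow> conj_within (k + l) u w"
proof -
  assume "conj_within k u v" "conj_within l v w"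
  then obtain g h where "conj_by g u v" "word_len g \<le> k" "conj_by h v w" "word_len h \<le> l"
    by (auto simp: conj_within_def)
  then show ?thesis
    using word_len_add_le[of h l g k] by (intro conj_withinI[OF conj_by_trans]) (auto simp: add.commute)
qed

lemma conj_within_sym: "conj_within k u v \<Longrightarrow> conj_within k v u"
  unfolding conj_within_def by (metis conj_by_sym word_len_minus)

text \<open>Doubling the word also tests the junction from the last syllable to the first, and makes
  invariance under rotation easy to see.\<close>

definition cyc_reduced :: "syls \<Rightarrow> bool" where
  "cyc_reduced xs \<longleftrightarrow> reduced (xs @ xs)"

lemma cyc_reduced_iff: "xs \<noteq> [] \<Longrightarrow> cyc_reduced xs \<longleftrightarrow> reduced xs \<and> no_pinch (last xs) (hd xs)"
  by (auto simp: cyc_reduced_def successively_append_iff)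

lemma cyc_reduced_reduced: "cyc_reduced xs \<Longrightarrow> reduced xs"
  by (auto simp: cyc_reduced_def successively_append_iff)

lemma cyc_reduced_rotate: "cyc_reduced (xs @ ys) \<Longrightarrow> cyc_reduced (ys @ xs)"
proof (cases "xs = [] \<or> ys = []")
  case False
  then show "cyc_reduced (xs @ ys) \<Longrightarrow> cyc_reduced (ys @ xs)"
    by (simp add: cyc_reduced_def successively_append_iff)
qed auto

lemma seq_cost_add_last:
  assumes "xs \<noteq> []" "seq_cost n xs" "cost m c" shows "seq_cost (n + m) (add_last xs c)"
proof -
  obtain ys e b where xs: "xs = ys @ [(e, b)]" using assms(1) by (metis rev_exhaust surj_pair)
  obtain i k where "seq_cost i ys" "cost k b" "i + (k + 1) \<le> n"
    using assms(2) unfolding xs seq_cost_append by (auto intro: order_trans)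
  moreover from this have "seq_cost (k + m + 1) [(e, b + c)]"
    using cost_add[OF _ assms(3), of k b] by auto
  ultimately show ?thesis
    unfolding xs add_last_def seq_cost_append by (intro exI[of _ i] exI[of _ "k + m + 1"]) simp
qed

lemma seq_mult_right:
  assumes "reduced xs" "cost m b" "seq_cost n xs" "cost k c"
  obtains b' xs' m' n' where "emb b + seq_val xs + emb c = emb b' + seq_val xs'" "reduced xs'"
    "length xs' = length xs" "cost m' b'" "seq_cost n' xs'" "m' + n' \<le> m + n + k"
proof (cases "xs = []")
  case True
  then show thesis using that[of "b + c" "[]" "m + k" 0] assms by (simp add: emb_add cost_add)
next
  case False
  then show thesis
    using that[of b "add_last xs c" m "n + k"] assms
    by (simp add: seq_val_add_last reduced_add_last length_add_last seq_cost_add_last add.assoc)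
qed

text \<open>Each round moves \<open>h\<close> into the last syllable and, if the word pinches
  cyclically, conjugates by one stable letter, which removes two of them. A round costs at most n +
  1. The budget \<open>n\<close> does not grow, because the 2 in \<open>cost_stable\<close> is paid
  by the two removed letters.\<close>

lemma cyclic_reduction:
  assumes "reduced xs" "cost c h" "seq_cost d xs" "c + d \<le> n"
  shows "(\<exists>h'. cost n h' \<and> conj_within (length xs * (n + 1)) (emb h + seq_val xs) (emb h')) \<or>
    (\<exists>ys. ys \<noteq> [] \<and> cyc_reduced ys \<and> seq_cost n ys \<and>
       conj_within (length xs * (n + 1)) (emb h + seq_val xs) (seq_val ys))"
  using assms
proof (induction "length xs" arbitrary: xs c h d rule: less_induct)
  case less
  show ?case
  proof (cases "xs = []")
    case True
    have "cost n h" using less.prems by (auto intro: cost_mono)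
    then show ?thesis using True by (auto intro: conj_within_refl)
  next
    case False
    define xs' where "xs' = add_last xs h"
    have xs': "reduced xs'" "length xs' = length xs" "xs' \<noteq> []"
      using less.prems False by (auto simp: xs'_def reduced_add_last length_add_last) (simp add: add_last_def)
    have cost': "seq_cost n xs'"
      unfolding xs'_def
      by (rule seq_cost_mono[OF seq_cost_add_last[OF False less.prems(3,2)]]) (use less.prems(4) in simp)
    have conj1: "conj_within c (emb h + seq_val xs) (seq_val xs')"
    proof (rule conj_withinI)
      show "conj_by (- emb h) (emb h + seq_val xs) (seq_val xs')"
        using False by (simp add: conj_by_def xs'_def seq_val_add_last add.assoc)
    qed (use less.prems in \<open>simp add: word_len_cost\<close>)
    show ?thesis
    proof (cases "no_pinch (last xs') (hd xs')")
      case True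
      have "c \<le> length xs * (n + 1)" using less.prems(4) False by (cases xs) auto
      then show ?thesis
        using True xs' cost' conj_within_mono[OF conj1] by (auto simp: cyc_reduced_iff)
    next
      case np: False
      obtain e b rest where x: "xs' = (e, b) # rest" using xs'(3) by (cases xs') auto
      obtain e' b' where l: "last xs' = (e', b')" by (cases "last xs'")
      obtain j where e': "e = (\<not> e')" and b': "b' = sub e j" using np x l by (auto simp: no_pinch_def)
      have "rest \<noteq> []" using x l e' by auto
      moreover from this have "last rest = (\<not> e, sub e j)" using l e' b' x by simp
      ultimately obtain zs where rest: "rest = zs @ [(\<not> e, sub e j)]"
        by (cases rest rule: rev_cases) auto
      obtain m k1 k2 k3 where k: "cost m b" "seq_cost k1 zs" "cost k3 (sub e j)" "m + k1 + k3 + 2 \<le> n"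
      proof -
        obtain m k where 1: "cost m b" "seq_cost k (zs @ [(\<not> e, sub e j)])" "m + k + 1 \<le> n"
          using cost' unfolding x rest by auto
        obtain k1 k4 where 2: "seq_cost k1 zs" "seq_cost k4 [(\<not> e, sub e j)]" "k1 + k4 \<le> k"
          using 1(2) unfolding seq_cost_append by blast
        obtain k3 where "cost k3 (sub e j)" "k3 + 1 \<le> k4" using 2(2) by auto
        then show thesis using that[of m k1 k3] 1 2 by simp
      qed
      have zs: "reduced zs" using xs'(1) unfolding x rest
        by (auto simp: successively_append_iff successively_Cons)
      have "cost (k3 + 2) (sub (\<not> e) j)" using cost_stable[of k3 "\<not> e" j] k(3) by simp
      from seq_mult_right[OF zs k(1,2) this]
      obtain b2 zs2 m2 n2 where 2: "emb b + seq_val zs + emb (sub (\<not> e) j) = emb b2 + seq_val zs2" "reduced zs2"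
        "length zs2 = length zs" "cost m2 b2" "seq_cost n2 zs2" "m2 + n2 \<le> m + k1 + (k3 + 2)" by metis
      have "conj_by (- stable_letter e) (seq_val xs') (emb b2 + seq_val zs2)"
      proof -
        have "emb b2 + seq_val zs2 = emb b + seq_val zs + emb (sub (\<not> e) j)" using 2 by simp
        also have "emb (sub (\<not> e) j) = - stable_letter e + (emb (sub e j) + stable_letter e)"
          by (simp add: emb_sub_stable)
        finally show ?thesis
          by (simp add: conj_by_def x rest seq_val_append stable_Not group_simps del: add_uminus_conv_diff)
      qed
      then have conj2: "conj_within 1 (seq_val xs') (emb b2 + seq_val zs2)"
        by (rule conj_withinI) (use word_len_stable in simp)
      have len: "length zs2 + 2 = length xs" using 2(3) xs'(2) x rest by simp
      have conj3: "conj_within (c + 1) (emb h + seq_val xs) (emb b2 + seq_val zs2)"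
        using conj_within_trans[OF conj1 conj2] .
      have le: "c + 1 + length zs2 * (n + 1) \<le> length xs * (n + 1)"
        using less.prems(4) by (simp flip: len)
      have tr: "conj_within (length xs * (n + 1)) (emb h + seq_val xs) v"
        if "conj_within (length zs2 * (n + 1)) (emb b2 + seq_val zs2) v" for v
        using conj_within_mono[OF conj_within_trans[OF conj3 that] le] .
      have "length zs2 < length xs" "m2 + n2 \<le> n" using len 2(6) k(4) by auto
      from less.hyps[OF this(1) 2(2,4,5) this(2)] show ?thesis using tr by blast
    qed
  qed
qed

section \<open>Conjugacy of cyclically reduced elements\<close>

text \<open>The counterpart of \<open>reduced_eq_step\<close> at the right end: the discrepancies
  travel through the word and arrive as a left factor of the last group element.\<close>

lemma reduced_eq_last:
  assumes "reduced xs" "reduced ys" "emb h + seq_val xs = emb h' + seq_val ys"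
  shows "length xs = length ys \<and> (xs \<noteq> [] \<longrightarrow> fst (last xs) = fst (last ys) \<and>
    (\<exists>j. snd (last ys) = sub (\<not> fst (last xs)) j + snd (last xs)))"
  using assms
proof (induction xs arbitrary: h h' ys)
  case Nil
  then show ?case using reduced_eq_step[of "[]" ys h h'] by auto
next
  case (Cons x xs)
  show ?case
  proof (rule reduced_eq_step[OF Cons.prems])
    fix e b xs' b' ys' j
    assume 1: "x # xs = (e, b) # xs'" "ys = (e, b') # ys'" "h = h' + sub e j"
      "emb (sub (\<not> e) j + b) + seq_val xs' = emb b' + seq_val ys'"
    have red: "reduced xs" "reduced ys'" using Cons.prems 1 by (auto simp: successively_Cons)
    have "emb (sub (\<not> e) j + b) + seq_val xs = emb b' + seq_val ys'" using 1 by simp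
    note IH = Cons.IH[OF red this]
    show ?thesis
    proof (cases "xs = []")
      case True
      then have "ys' = []" using IH by auto
      then have "emb (sub (\<not> e) j + b) = emb b'" using 1 True by simp
      then have "b' = sub (\<not> e) j + b" by (metis emb_inj)
      then show ?thesis using True \<open>ys' = []\<close> 1 by auto
    next
      case False
      then have "ys' \<noteq> []" using IH by auto
      then show ?thesis using False IH 1 by auto
    qed
  qed auto
qed

definition syl_form :: "nat \<Rightarrow> bg \<Rightarrow> bool" where
  "syl_form k g \<longleftrightarrow> (\<exists>h xs. g = emb h + seq_val xs \<and> reduced xs \<and> length xs = k)"

lemma syl_formI: "reduced xs \<Longrightarrow> syl_form (length xs) (emb h + seq_val xs)"
  by (auto simp: syl_form_def)

lemma syl_form_emb_right: "reduced xs \<Longrightarrow> syl_form (length xs) (emb h + seq_val xs + emb c)"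
proof (cases "xs = []")
  case True
  then show ?thesis using syl_formI[of "[]" "h + c"] by (simp add: emb_add)
next
  case False
  assume "reduced xs"
  then show ?thesis using False syl_formI[of "add_last xs c" h]
    by (simp add: reduced_add_last length_add_last seq_val_add_last add.assoc)
qed

lemma syl_form_total: obtains k where "syl_form k g"
proof -
  obtain w where "g = abs_bg w" by (rule abs_bg_cases)
  moreover obtain h xs c d where "abs_bg w = emb h + seq_val xs" "reduced xs"
    by (rule reduced_decomposition)
  ultimately show thesis using that syl_formI by metis
qed

lemma conj_by_rotate_source:
  assumes "conj_by g (seq_val (xs @ ys)) v" shows "conj_by (g + seq_val xs) (seq_val (ys @ xs)) v"
proof (rule conj_by_trans[OF _ assms])
  show "conj_by (seq_val xs) (seq_val (ys @ xs)) (seq_val (xs @ ys))"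
    by (simp add: conj_by_def seq_val_append add.assoc)
qed

lemma conj_by_rotate_back:
  assumes "conj_by g (seq_val (ys @ xs)) v" shows "conj_by (g - seq_val xs) (seq_val (xs @ ys)) v"
proof -
  have "conj_by (- seq_val xs) (seq_val (xs @ ys)) (seq_val (ys @ xs))"
    by (simp add: conj_by_def seq_val_append add.assoc)
  from conj_by_trans[OF this assms] show ?thesis by simp
qed

lemma conj_by_rotate_target:
  assumes "conj_by g u (seq_val (ys @ xs))" shows "conj_by (seq_val xs + g) u (seq_val (xs @ ys))"
proof (rule conj_by_trans[OF assms])
  show "conj_by (seq_val xs) (seq_val (ys @ xs)) (seq_val (xs @ ys))"
    by (simp add: conj_by_def seq_val_append add.assoc)
qed

lemma rotate_split: obtains xs1 xs2 where "xs = xs1 @ xs2" "rotate i xs = xs2 @ xs1"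
  using rotate_drop_take[of i xs] append_take_drop_id by metis

lemma conj_within_rotate:
  assumes "seq_cost n xs" shows "conj_within n (seq_val xs) (seq_val (rotate i xs))"
proof -
  obtain xs1 xs2 where x: "xs = xs1 @ xs2" "rotate i xs = xs2 @ xs1" by (rule rotate_split)
  have "seq_cost n xs1" using assms by (auto simp: x(1) seq_cost_append intro: seq_cost_mono)
  moreover have "conj_by (- seq_val xs1) (seq_val (xs1 @ xs2)) (seq_val (xs2 @ xs1))"
    by (simp add: conj_by_def seq_val_append add.assoc)
  ultimately show ?thesis using x by (intro conj_withinI) (auto simp: word_len_seq_cost)
qed

lemma rotate_invariants:
  "seq_cost n xs \<Longrightarrow> seq_cost n (rotate i xs)" "cyc_reduced xs \<Longrightarrow> cyc_reduced (rotate i xs)"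
proof -
  obtain xs1 xs2 where x: "xs = xs1 @ xs2" "rotate i xs = xs2 @ xs1" by (rule rotate_split)
  show "seq_cost n xs \<Longrightarrow> seq_cost n (rotate i xs)" using seq_cost_rotate x by metis
  show "cyc_reduced xs \<Longrightarrow> cyc_reduced (rotate i xs)" using cyc_reduced_rotate x by metis
qed

text \<open>Used when the target is rotated by its last syllable: that syllable pinches with the
  first letter of the conjugator, which loses one stable letter.\<close>

lemma shorten_left:
  assumes "reduced zs" "zs \<noteq> []" "ys \<noteq> []" "\<not> no_pinch (last (add_last ys b)) (hd zs)"
  shows "syl_form (length zs - 1) (seq_val [last ys] + (emb b + seq_val zs))"
proof -
  obtain e b1 zs' where z: "zs = (e, b1) # zs'" using assms(2) by (cases zs) auto
  obtain e' b' where y: "last ys = (e', b')" by (cases "last ys")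
  obtain j where e': "e' = (\<not> e)" and j: "b' + b = sub e j"
    using assms(4) by (auto simp: add_last_def y z no_pinch_def)
  have "seq_val [last ys] + (emb b + seq_val zs)
    = - stable_letter e + (emb (sub e j) + stable_letter e) + emb b1 + seq_val zs'"
    by (simp add: y z e' stable_Not add.assoc flip: j) (simp add: emb_add add.assoc)
  also have "\<dots> = emb (sub (\<not> e) j + b1) + seq_val zs'"
    by (simp add: emb_sub_stable emb_add add.assoc)
  finally show ?thesis using assms(1) syl_formI[of zs' "sub (\<not> e) j + b1"]
    by (auto simp: z successively_Cons)
qed

lemma shorten_right:
  assumes "reduced (zs @ [(e, c)])" "c = sub (\<not> e) j"
  shows "syl_form (length zs) (emb b + seq_val (zs @ [(e, c)]) - stable_letter e + emb x)"
proof -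
  have "emb b + seq_val (zs @ [(e, c)]) - stable_letter e + emb x
     = emb b + seq_val zs + (stable_letter e + emb (sub (\<not> e) j)) - stable_letter e + emb x"
    by (simp add: seq_val_append assms(2) add.assoc)
  also have "\<dots> = emb b + seq_val zs + emb (sub e j + x)"
    by (simp only: emb_sub_stable[symmetric] emb_add)
      (simp add: group_simps del: add_uminus_conv_diff)
  finally show ?thesis using assms(1) syl_form_emb_right[of zs b "sub e j + x"]
    by (simp add: successively_append_iff)
qed

text \<open>Collins' lemma: the conjugator is shortened by rotating one of the two cyclic words as long as
  it has a letter \<open>t\<^sup>\<plusminus>\<^sup>1\<close>.\<close>

lemma collins_hyperbolic:
  assumes "syl_form k g" "conj_by g (seq_val xs) (seq_val ys)" "xs \<noteq> []" "ys \<noteq> []"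
    "cyc_reduced xs" "cyc_reduced ys"
  shows "\<exists>i j c. conj_by (emb c) (seq_val (rotate i xs)) (seq_val (rotate j ys))"
  using assms
proof (induction k arbitrary: g xs ys rule: less_induct)
  case (less k)
  obtain b zs where g: "g = emb b + seq_val zs" "reduced zs" "length zs = k"
    using less.prems(1) by (auto simp: syl_form_def)
  show ?case
  proof (cases "zs = []")
    case True
    then show ?thesis using less.prems(2) g(1) by (intro exI[of _ "0::nat"] exI[of _ b]) simp
  next
    case False
    then obtain zs0 e c where z: "zs = zs0 @ [(e, c)]" by (metis rev_exhaust surj_pair)
    have k: "length zs0 < k" using g(3) z by simp
    obtain f x xs' where x: "xs = (f, x) # xs'" using less.prems(3) by (cases xs) auto
    consider (right) "\<not> no_pinch (e, c) (f, x)"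
      | (left) "\<not> no_pinch (last (add_last ys b)) (hd zs)"
      | (none) "no_pinch (e, c) (f, x)" "no_pinch (last (add_last ys b)) (hd zs)" by blast
    then show ?thesis
    proof cases
      case right
      then obtain j where f: "f = (\<not> e)" and c: "c = sub (\<not> e) j" by (auto simp: no_pinch_def)
      have "g + seq_val [(f, x)] = emb b + seq_val zs - stable_letter e + emb x"
        by (simp add: g(1) f stable_Not group_simps del: add_uminus_conv_diff)
      then have "syl_form (length zs0) (g + seq_val [(f, x)])"
        using shorten_right[of zs0 e c j b x] g(2) c z by simp
      moreover have "conj_by (g + seq_val [(f, x)]) (seq_val (rotate 1 xs)) (seq_val ys)"
        using conj_by_rotate_source[of g "[(f, x)]" xs'] less.prems(2) x by simp
      ultimately have "\<exists>i j c. conj_by (emb c) (seq_val (rotate i (rotate 1 xs))) (seq_val (rotate j ys))"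
        using less.prems by (intro less.IH[OF k]) (auto simp: rotate_invariants simp del: rotate_Suc)
      then show ?thesis unfolding rotate_rotate by blast
    next
      case left
      have "ys = butlast ys @ [last ys]" using less.prems(4) by simp
      then have rot: "rotate (length (butlast ys)) ys = [last ys] @ butlast ys"
        by (metis rotate_append)
      have sf: "syl_form (length zs - 1) (seq_val [last ys] + g)"
        unfolding g(1) using g(2) False less.prems(4) left by (rule shorten_left)
      have cj: "conj_by (seq_val [last ys] + g) (seq_val xs) (seq_val (rotate (length (butlast ys)) ys))"
        unfolding rot using less.prems(2,4) by (intro conj_by_rotate_target) simp
      have "length zs - 1 < k" using g(3) False by (cases zs) auto
      then have "\<exists>i j c. conj_by (emb c) (seq_val (rotate i xs)) (seq_val (rotate j (rotate (length (butlast ys)) ys)))"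
        using less.IH[OF _ sf cj] less.prems rotate_invariants(2) by simp
      then show ?thesis unfolding rotate_rotate by blast
    next
      case none
      \<comment> \<open>Both sides of g xs = ys g are now reduced, so their last syllables agree up
        to a left factor from \<open>sub (\<not> e)\<close>. Hence \<open>g\<close> ends like
        \<open>xs\<close>, and cancelling the last syllable of \<open>xs\<close> from
        \<open>g\<close> removes a stable letter.\<close>
      have "reduced (zs @ xs)"
        using none(1) g(2) cyc_reduced_reduced[OF less.prems(5)] by (simp add: successively_append_iff z x)
      moreover have "reduced (add_last ys b @ zs)"
        using none(2) g(2) False reduced_add_last[OF less.prems(4) cyc_reduced_reduced[OF less.prems(6)]]
        by (auto simp: successively_append_iff)
      moreover have "emb b + seq_val (zs @ xs) = emb 0 + seq_val (add_last ys b @ zs)"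
        using less.prems(2,4) by (simp add: conj_by_def g(1) seq_val_append seq_val_add_last add.assoc)
      ultimately have last: "fst (last (zs @ xs)) = fst (last (add_last ys b @ zs))"
          "\<exists>j. snd (last (add_last ys b @ zs)) = sub (\<not> fst (last (zs @ xs))) j + snd (last (zs @ xs))"
        using reduced_eq_last False by (metis append_is_Nil_conv)+
      obtain xs0 x1 where xl: "xs = xs0 @ [(e, x1)]"
        using last(1) less.prems(3) z by (cases xs rule: rev_cases) auto
      obtain j where c: "c = sub (\<not> e) j + x1" using last(2) by (auto simp: xl z)
      have "g - seq_val [(e, x1)] = emb b + seq_val (zs0 @ [(e, sub (\<not> e) j)]) - stable_letter e + emb 0"
        by (simp add: g(1) z c seq_val_append emb_add group_simps del: add_uminus_conv_diff)
      moreover have "reduced (zs0 @ [(e, sub (\<not> e) j)])"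
        using g(2) by (auto simp: z successively_append_iff no_pinch_def)
      ultimately have sf: "syl_form (length zs0) (g - seq_val [(e, x1)])"
        using shorten_right[of zs0 e "sub (\<not> e) j" j b 0] by simp
      have rot: "rotate (length xs0) xs = [(e, x1)] @ xs0" unfolding xl by (rule rotate_append)
      have cj: "conj_by (g - seq_val [(e, x1)]) (seq_val (rotate (length xs0) xs)) (seq_val ys)"
        unfolding rot using less.prems(2) xl by (intro conj_by_rotate_back) simp
      have "\<exists>i j c. conj_by (emb c) (seq_val (rotate i (rotate (length xs0) xs))) (seq_val (rotate j ys))"
        using less.IH[OF k sf cj] less.prems rotate_invariants(2) by simp
      then show ?thesis unfolding rotate_rotate by blast
    qed
  qed
qed

text \<open>Counting stable letters in g h = ys g: without a pinch between \<open>ys\<close> and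
  \<open>g\<close> the right side has more of them. With a pinch, rotating \<open>ys\<close>
  shortens \<open>g\<close>.\<close>

lemma elliptic_not_hyperbolic:
  assumes "syl_form k g" "conj_by g (emb h) (seq_val ys)" "ys \<noteq> []" "cyc_reduced ys"
  shows False
  using assms
proof (induction k arbitrary: g ys rule: less_induct)
  case (less k)
  obtain b zs where g: "g = emb b + seq_val zs" "reduced zs" "length zs = k"
    using less.prems(1) by (auto simp: syl_form_def)
  have red: "reduced (add_last ys b)"
    using reduced_add_last[OF less.prems(3) cyc_reduced_reduced[OF less.prems(4)]] .
  have len: "length (add_last ys b) > 0" using less.prems(3) by (simp add: length_add_last)
  show ?case
  proof (cases "zs = []")
    case True
    have "emb (b + h) + seq_val [] = emb 0 + seq_val (add_last ys b)"
      using less.prems(2,3) True by (simp add: conj_by_def g(1) emb_add seq_val_add_last)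
    from reduced_eq_last[OF _ red this] len show False by simp
  next
    case False
    show False
    proof (cases "no_pinch (last (add_last ys b)) (hd zs)")
      case True
      have "reduced (add_last ys b @ zs)" using True red g(2) by (simp add: successively_append_iff)
      moreover have "reduced (add_last zs h)" using False g(2) by (rule reduced_add_last)
      moreover have "emb b + seq_val (add_last zs h) = emb 0 + seq_val (add_last ys b @ zs)"
        using less.prems(2,3) False
        by (simp add: conj_by_def g(1) seq_val_append seq_val_add_last add.assoc)
      ultimately have "length (add_last zs h) = length (add_last ys b @ zs)"
        using reduced_eq_last by blast
      then show False using len False by (simp add: length_add_last)
    next
      case np: False
      have "ys = butlast ys @ [last ys]" using less.prems(3) by simp
      then have rot: "cyc_reduced ([last ys] @ butlast ys)"
        using less.prems(4) cyc_reduced_rotate by metis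
      have sf: "syl_form (length zs - 1) (seq_val [last ys] + g)"
        unfolding g(1) using g(2) False less.prems(3) np by (rule shorten_left)
      have cj: "conj_by (seq_val [last ys] + g) (emb h) (seq_val ([last ys] @ butlast ys))"
        using less.prems(2,3) by (intro conj_by_rotate_target) simp
      have "length zs - 1 < k" using g(3) False by (cases zs) auto
      from less.IH[OF this sf cj _ rot] show False by simp
    qed
  qed
qed

section \<open>Bounded conjugators between hyperbolic elements\<close>

lemma dyadic_abs_ge:
  fixes r :: real
  assumes "r * 2 ^ f = of_int z" "r \<noteq> 0" shows "1 \<le> \<bar>r\<bar> * (2::real) ^ f"
proof -
  have "z \<noteq> 0" using assms by auto
  then have "1 \<le> \<bar>real_of_int z\<bar>" by linarith
  then show ?thesis by (simp flip: assms(1) add: abs_mult)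
qed

text \<open>A nonzero number with denominator 2^f is at least 2^-f in absolute value, so the ratio
  r'/r is at most 2^(2f) 2^f.\<close>

lemma ratio_exponent_le:
  fixes r :: real
  assumes "2 powi i * r = r'" "r \<noteq> 0" "\<bar>r'\<bar> \<le> 2 ^ (2 * f)" "r * 2 ^ f = of_int z"
  shows "i \<le> 3 * int f"
proof (rule ccontr)
  assume "\<not> i \<le> 3 * int f"
  then have "2 powi int (3 * f) < (2 powi i :: real)" by (intro power_int_strict_increasing) auto
  then have "2 ^ (3 * f) < (2 powi i :: real)" by (simp only: power_int_of_nat)
  also have "\<dots> \<le> 2 powi i * (\<bar>r\<bar> * 2 ^ f)"
    using mult_left_mono[OF dyadic_abs_ge[OF assms(4,2)], of "2 powi i"] by simp
  also have "\<dots> = \<bar>r'\<bar> * 2 ^ f" by (simp flip: assms(1) add: abs_mult)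
  also have "\<dots> \<le> 2 ^ (2 * f) * 2 ^ f" using assms(3) by (intro mult_right_mono) auto
  also have "\<dots> = 2 ^ (3 * f)" by (simp flip: power_add)
  finally show False by simp
qed

lemma ratio_exponent:
  assumes "2 powi i * transl h = transl h'" "transl h \<noteq> 0" "cost n h" "cost n h'"
  shows "\<bar>i\<bar> \<le> 3 * int (growth n)"
proof -
  obtain z z' :: int where z: "transl h * 2 ^ growth n = of_int z" "transl h' * 2 ^ growth n = of_int z'"
    using cost_coarse_bounds(3) assms(3,4) by meson
  have "transl h' \<noteq> 0" using assms(1,2) by (metis mult_eq_0_iff power_int_eq_0_iff zero_neq_numeral)
  moreover have "2 powi (- i) * transl h' = transl h"
    by (simp flip: assms(1) add: power_int_minus)
  ultimately have "- i \<le> 3 * int (growth n)"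
    using z cost_coarse_bounds(1)[OF assms(3)] by (intro ratio_exponent_le)
  moreover have "i \<le> 3 * int (growth n)"
    using assms z cost_coarse_bounds(1)[OF assms(4)] by (intro ratio_exponent_le)
  ultimately show ?thesis by simp
qed

lemma int_less_two_power: "int m < 2 ^ m"
  using less_exp[of m] by (metis of_nat_less_iff of_nat_numeral of_nat_power)

text \<open>In the excluded case \<open>e = True\<close>, \<open>e2 = False\<close> the equation relates \<open>j\<close> only to
  \<open>2 powi expo b' * j2\<close> and does not bound it.\<close>

lemma step_exponent:
  assumes "sub (\<not> e) j + b = b' + sub e2 j2" "cost n b" "cost n b'" "e \<longrightarrow> e2" "no_pinch (e, b) (e2, x)"
  shows "\<bar>j\<bar> \<le> 2 ^ (3 * growth n + 1)"
proof -
  define f where "f = growth n"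
  note bnd = cost_coarse_bounds[OF assms(2)] cost_coarse_bounds[OF assms(3)]
  have le: "3 * int f \<le> 2 ^ (3 * f + 1)"
    using int_less_two_power[of "3 * f"] by simp
  consider "e" "e2" | "\<not> e" "\<not> e2" | "\<not> e" "e2" using assms(4) by blast
  then show ?thesis
  proof cases
    case 1
    then have "of_int j + transl b = transl b'" using assms(1) by (simp add: bs_eq_iff)
    then have "\<bar>real_of_int j\<bar> \<le> 2 * 2 ^ (2 * f)" using bnd unfolding f_def by linarith
    also have "\<dots> \<le> (2::real) ^ (3 * f + 1)" by (simp add: power_increasing)
    finally have "real_of_int \<bar>j\<bar> \<le> real_of_int (2 ^ (3 * f + 1))" by simp
    then show ?thesis unfolding f_def of_int_le_iff .
  next
    case 2
    then have "j + expo b = expo b'" using assms(1) by (simp add: bs_eq_iff)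
    then have "\<bar>j\<bar> \<le> 3 * int f" using bnd unfolding f_def by linarith
    then show ?thesis using le unfolding f_def by linarith
  next
    case 3
    then have eq: "2 powi j * transl b = transl b'" using assms(1) by (simp add: bs_eq_iff)
    \<comment> \<open>A zero translation would leave \<open>j\<close> free, but then t^-1 b t would
      be a pinch.\<close>
    have "transl b \<noteq> 0"
    proof
      assume "transl b = 0"
      then have "b = sub True (expo b)" by (intro bs_eqI) simp_all
      then have "b \<in> range (sub True)" by (rule range_eqI)
      then show False using assms(5) 3 by (simp add: no_pinch_def)
    qed
    then have "\<bar>j\<bar> \<le> 3 * int f" using ratio_exponent[OF eq _ assms(2,3)] by (simp add: f_def)
    then show ?thesis using le unfolding f_def by linarith
  qed
qed

text \<open>In c xs = ys c, the first stable letter forces \<open>c\<close> into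
  \<open>sub e\<close>, and the second gives an equation between the first group elements of both
  words. The second letter is taken cyclically, as \<open>hd (xs' @ xs)\<close>, so that words with
  a single syllable are included.\<close>

lemma conj_first_step:
  assumes "conj_by (emb c) (seq_val xs) (seq_val ys)" "xs \<noteq> []" "ys \<noteq> []" "cyc_reduced xs" "cyc_reduced ys"
  obtains e b xs' b' ys' j e2 j2 x where "c = sub e j" "xs = (e, b) # xs'" "ys = (e, b') # ys'"
    "hd (xs' @ xs) = (e2, x)" "sub (\<not> e) j + b = b' + sub e2 j2" "no_pinch (e, b) (e2, x)"
proof -
  have red: "reduced xs" "reduced (add_last ys c)"
    using assms by (auto intro: cyc_reduced_reduced reduced_add_last)
  have eq: "emb c + seq_val xs = emb 0 + seq_val (add_last ys c)"
    using assms(1,3) by (simp add: conj_by_def seq_val_add_last)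
  obtain e b xs' b1 ys1 j where 1: "xs = (e, b) # xs'" "add_last ys c = (e, b1) # ys1" "c = sub e j"
    "emb (sub (\<not> e) j + b) + seq_val xs' = emb b1 + seq_val ys1"
    using reduced_eq_step[OF red eq] assms(2) by (metis add.left_neutral)
  obtain e2 x where hd: "hd (xs' @ xs) = (e2, x)" by (cases "hd (xs' @ xs)")
  have np: "no_pinch (e, b) (e2, x)"
  proof -
    have "reduced (([(e, b)] @ xs') @ xs)" using assms(4) 1(1) by (simp add: cyc_reduced_def)
    then show ?thesis using hd assms(2) by (simp add: successively_Cons)
  qed
  have red': "reduced xs'" "reduced ys1"
    using red unfolding 1(1,2) by (auto simp: successively_Cons)
  show thesis
  proof (cases "tl ys = []")
    case True
    then obtain b' where y: "ys = [(e, b')]" "b1 = b' + c" "ys1 = []"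
      using 1(2) assms(3) by (cases ys) (auto simp: add_last_def)
    then have "xs' = []" using reduced_eq_step[OF red' 1(4)] by auto
    then have "e2 = e" "emb (sub (\<not> e) j + b) = emb (b' + sub e j)" using hd 1 y by auto
    then have "sub (\<not> e) j + b = b' + sub e2 j" using emb_inj by simp
    then show thesis using that[of e j b xs' b' "[]" e2 x j] 1 y hd np by simp
  next
    case False
    then obtain ys' where y: "ys = (e, b1) # ys'" "ys1 = add_last ys' c" "ys' \<noteq> []"
      using 1(2) assms(3) by (cases ys) (auto simp: add_last_def)
    show thesis
    proof (rule reduced_eq_step[OF red' 1(4)])
      fix e3 b3 xs3 b4 ys4 j3
      assume 3: "xs' = (e3, b3) # xs3" "sub (\<not> e) j + b = b1 + sub e3 j3"
      then have "e2 = e3" using hd by simp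
      then show thesis using that[of e j b xs' b1 ys' e2 x j3] 1 y hd np 3 by simp
    qed (use y in \<open>simp add: add_last_def\<close>)
  qed
qed

lemma word_len_sub_le:
  assumes "\<bar>j\<bar> \<le> 2 ^ m" shows "word_len (emb (sub e j)) \<le> 2 ^ m + 2"
proof -
  have "nat \<bar>j\<bar> \<le> 2 ^ m" using assms by (simp add: nat_le_iff)
  then show ?thesis using word_len_sub[of e j] by linarith
qed

text \<open>If the word starts with t followed by t^-1, \<open>step_exponent\<close> does not apply.
  Rotating both words by one syllable turns the conjugator into \<open>sub e2 j2\<close> and makes
  t^-1 the first letter, where it does apply; the two rotations cost 2 n.\<close>

lemma hyperbolic_conj_emb:
  assumes "conj_by (emb c) (seq_val xs) (seq_val ys)" "xs \<noteq> []" "ys \<noteq> []" "cyc_reduced xs" "cyc_reduced ys"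
    "seq_cost n xs" "seq_cost n ys"
  shows "conj_within (2 * n + 2 ^ (3 * growth n + 1) + 2) (seq_val xs) (seq_val ys)"
proof -
  obtain e b xs' b' ys' j e2 j2 x where 1: "c = sub e j" "xs = (e, b) # xs'" "ys = (e, b') # ys'"
    "hd (xs' @ xs) = (e2, x)" "sub (\<not> e) j + b = b' + sub e2 j2" "no_pinch (e, b) (e2, x)"
    using assms(1-5) by (rule conj_first_step)
  have cost: "cost n b" "cost n b'"
    using seq_cost_mem[OF assms(6)] seq_cost_mem[OF assms(7)] 1 by auto
  show ?thesis
  proof (cases "e \<longrightarrow> e2")
    case True
    have "word_len (emb c) \<le> 2 ^ (3 * growth n + 1) + 2"
      unfolding 1(1) by (intro word_len_sub_le step_exponent[OF 1(5) cost True 1(6)])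
    then show ?thesis using assms(1) by (intro conj_withinI) auto
  next
    case False
    then have e: "e" "\<not> e2" by auto
    then have ne: "xs' \<noteq> []" using 1 by auto
    have rot: "rotate 1 xs = xs' @ [(e, b)]" "rotate 1 ys = ys' @ [(e, b')]" by (simp_all add: 1)
    have "conj_by (emb c + seq_val [(e, b)]) (seq_val (rotate 1 xs)) (seq_val ys)"
      unfolding rot using conj_by_rotate_source[of "emb c" "[(e, b)]" xs' "seq_val ys"] assms(1) 1 by simp
    moreover have "conj_by (- seq_val [(e, b')]) (seq_val ys) (seq_val (rotate 1 ys))"
      unfolding rot by (simp add: conj_by_def 1 seq_val_append group_simps del: add_uminus_conv_diff)
    ultimately have "conj_by (- seq_val [(e, b')] + (emb c + seq_val [(e, b)])) (seq_val (rotate 1 xs)) (seq_val (rotate 1 ys))"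
      by (rule conj_by_trans)
    also have "- seq_val [(e, b')] + (emb c + seq_val [(e, b)])
      = - emb b' + (- stable_letter e + (emb (sub e j) + stable_letter e)) + emb b"
      by (simp add: 1(1) group_simps del: add_uminus_conv_diff)
    also have "\<dots> = - emb b' + emb (sub (\<not> e) j + b)"
      by (simp only: emb_sub_stable minus_add_cancel emb_add add.assoc)
    also have "\<dots> = emb (sub e2 j2)"
      unfolding 1(5) emb_add by simp
    finally have cj: "conj_by (emb (sub e2 j2)) (seq_val (rotate 1 xs)) (seq_val (rotate 1 ys))" .
    have cr: "cyc_reduced (rotate 1 xs)" "cyc_reduced (rotate 1 ys)"
      "seq_cost n (rotate 1 xs)" "seq_cost n (rotate 1 ys)"
      using assms rotate_invariants by blast+
    obtain d p us p' vs i d2 i2 y where 2: "sub e2 j2 = sub d i" "rotate 1 xs = (d, p) # us"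
      "rotate 1 ys = (d, p') # vs" "sub (\<not> d) i + p = p' + sub d2 i2" "no_pinch (d, p) (d2, y)"
      using cr assms(2,3) by (rule_tac conj_first_step[OF cj]) simp_all
    have d: "\<not> d" using 2(2) 1(4) ne e unfolding rot by (cases xs') auto
    have cost2: "cost n p" "cost n p'"
      using seq_cost_mem[OF cr(3)] seq_cost_mem[OF cr(4)] unfolding 2 by auto
    have "word_len (emb (sub e2 j2)) \<le> 2 ^ (3 * growth n + 1) + 2"
      unfolding 2(1) using d by (intro word_len_sub_le step_exponent[OF 2(4) cost2 _ 2(5)]) simp
    then have mid: "conj_within (2 ^ (3 * growth n + 1) + 2) (seq_val (rotate 1 xs)) (seq_val (rotate 1 ys))"
      using cj by (intro conj_withinI)
    show ?thesis
      using conj_within_trans[OF conj_within_trans[OF conj_within_rotate[OF assms(6), of 1] mid]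
          conj_within_sym[OF conj_within_rotate[OF assms(7), of 1]]]
      by (rule conj_within_mono) simp
  qed
qed

lemma hyperbolic_conj:
  assumes "conj_by g (seq_val xs) (seq_val ys)" "xs \<noteq> []" "ys \<noteq> []" "cyc_reduced xs" "cyc_reduced ys"
    "seq_cost n xs" "seq_cost n ys"
  shows "conj_within (4 * n + 2 ^ (3 * growth n + 1) + 2) (seq_val xs) (seq_val ys)"
proof -
  obtain k where "syl_form k g" by (rule syl_form_total)
  then obtain i j c where "conj_by (emb c) (seq_val (rotate i xs)) (seq_val (rotate j ys))"
    using collins_hyperbolic assms(1-5) by blast
  then have "conj_within (2 * n + 2 ^ (3 * growth n + 1) + 2) (seq_val (rotate i xs)) (seq_val (rotate j ys))"
    using assms(2-7) by (intro hyperbolic_conj_emb rotate_invariants) auto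
  from conj_within_trans[OF conj_within_trans[OF conj_within_rotate[OF assms(6)] this]
      conj_within_sym[OF conj_within_rotate[OF assms(7)]]]
  show ?thesis by (rule conj_within_mono) simp
qed

section \<open>Bounded conjugators between elliptic elements\<close>

text \<open>Conjugation by s multiplies exponents of a by 2, and t exchanges powers of a and of s
  with the same exponent, so the odd part \<open>q\<close> is what all conjugations
  preserve.\<close>

definition odd_class :: "int \<Rightarrow> bs \<Rightarrow> bool" where
  "odd_class q h \<longleftrightarrow> odd q \<and> (\<exists>x e i. x + h = sub e (q * 2 ^ i) + x)"

lemma odd_part_exists: "j \<noteq> 0 \<Longrightarrow> \<exists>q i. odd q \<and> (j::int) = q * 2 ^ i"
proof (induction "nat \<bar>j\<bar>" arbitrary: j rule: less_induct)
  case less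
  show ?case
  proof (cases "odd j")
    case True
    then show ?thesis by (intro exI[of _ j] exI[of _ 0]) simp
  next
    case False
    then obtain m where m: "j = 2 * m" by blast
    then have "nat \<bar>m\<bar> < nat \<bar>j\<bar>" "m \<noteq> 0" using less.prems by auto
    then obtain q i where "odd q" "m = q * 2 ^ i" using less.hyps by blast
    then show ?thesis using m by (intro exI[of _ q] exI[of _ "Suc i"]) simp
  qed
qed

lemma odd_part_unique:
  assumes "2 powi m * (of_int q * 2 ^ i) = (of_int q' * 2 ^ i' :: real)" "odd q" "odd q'"
  shows "q = q'"
proof -
  have one_side: "q1 = q2" if "odd q1" "odd q2" "2 powi k * of_int q1 = (of_int q2 :: real)" "k \<ge> 0"
    for q1 q2 k :: int
  proof -
    have "of_int (2 ^ nat k * q1) = (of_int q2 :: real)" using that(3,4) by (simp add: power_int_def)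
    then have "2 ^ nat k * q1 = q2" by (simp only: of_int_eq_iff)
    then show ?thesis using that(1,2) by (cases "nat k") auto
  qed
  define k where "k = m + int i - int i'"
  have "2 powi k = 2 powi m * 2 ^ i / (2 ^ i' :: real)"
    by (simp add: k_def power_int_add power_int_diff)
  then have "2 powi k * of_int q * 2 ^ i' = (2 powi m * (of_int q * 2 ^ i) :: real)" by simp
  then have "2 powi k * of_int q * 2 ^ i' = (of_int q' * 2 ^ i' :: real)" unfolding assms(1) .
  then have k: "2 powi k * of_int q = (of_int q' :: real)" by simp
  show ?thesis
  proof (cases "k \<ge> 0")
    case True
    show ?thesis by (rule one_side[OF assms(2,3) k True])
  next
    case False
    have "2 powi (- k) * of_int q' = (of_int q :: real)" by (simp flip: k add: power_int_minus)
    then show ?thesis using one_side[of q' q "- k"] False assms(2,3) by simp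
  qed
qed

lemma odd_class_sub:
  assumes "odd_class q (sub e (q' * 2 ^ m))" "odd q'" shows "q = q'"
proof -
  obtain x e' i where x: "x + sub e (q' * 2 ^ m) = sub e' (q * 2 ^ i) + x" and "odd q"
    using assms(1) by (auto simp: odd_class_def)
  then have ne: "q \<noteq> 0" "q' \<noteq> 0" using assms(2) by auto
  show ?thesis
  proof (cases e)
    case True
    then have "q' * 2 ^ m = q * 2 ^ i" using x ne by (auto simp: bs_eq_iff split: if_splits)
    from arg_cong[OF this, of real_of_int] show ?thesis
      using odd_part_unique[of 0 q' m q i] assms(2) \<open>odd q\<close> by simp
  next
    case False
    then have "2 powi expo x * (of_int q' * 2 ^ m) = (of_int q * 2 ^ i :: real)"
      using x ne by (auto simp: bs_eq_iff split: if_splits)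
    then show ?thesis using odd_part_unique assms(2) \<open>odd q\<close> by metis
  qed
qed

lemma odd_class_conj: "x + h = h' + x \<Longrightarrow> odd_class q h' \<Longrightarrow> odd_class q h"
proof -
  assume x: "x + h = h' + x" and "odd_class q h'"
  then obtain y e i where "odd q" "y + h' = sub e (q * 2 ^ i) + y" by (auto simp: odd_class_def)
  moreover from this have "(y + x) + h = sub e (q * 2 ^ i) + (y + x)"
    using x by (metis add.assoc)
  ultimately show ?thesis by (auto simp: odd_class_def)
qed

text \<open>Every stable letter of the conjugator forces the current element into an edge subgroup,
  up to conjugacy in the Baumslag-Solitar group, as \<open>sub e j\<close>, and continues with
  \<open>sub (\<not> e) j\<close>, which has the same odd part. If \<open>j = 0\<close>, both
  elements are trivial.\<close>

lemma elliptic_conj: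
  assumes "reduced zs" "conj_by (emb x + seq_val zs) (emb h) (emb h')"
  shows "(\<exists>x. x + h = h' + x) \<or> (\<exists>q. odd_class q h \<and> odd_class q h')"
  using assms
proof (induction zs arbitrary: x h')
  case Nil
  then have "emb (x + h) = emb (h' + x)" by (simp add: conj_by_def emb_add)
  then show ?case using emb_inj by blast
next
  case (Cons z zs)
  obtain e b where z: "z = (e, b)" by (cases z)
  have eq: "emb x + seq_val (add_last (z # zs) h) = emb (h' + x) + seq_val (z # zs)"
    using Cons.prems(2) by (simp add: conj_by_def seq_val_add_last emb_add add.assoc)
  have red: "reduced (add_last (z # zs) h)" using Cons.prems(1) by (intro reduced_add_last) simp_all
  obtain j' where "x = h' + x + sub e j'"
    using reduced_eq_step[OF red Cons.prems(1) eq] z by (metis list.discI list.inject prod.inject)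
  then have "h' + x = x + - sub e j'" by (metis add.assoc add.right_neutral add.right_inverse)
  then obtain j where hx: "h' + x = x + sub e j" by (metis sub_minus)
  define R where "R = emb b + seq_val zs"
  have "emb x + stable_letter e + R + emb h = emb h' + (emb x + stable_letter e + R)"
    using Cons.prems(2) by (simp add: conj_by_def z R_def add.assoc)
  also have "\<dots> = emb (h' + x) + stable_letter e + R" by (simp add: emb_add add.assoc)
  also have "\<dots> = emb x + (emb (sub e j) + stable_letter e) + R" by (simp add: hx emb_add add.assoc)
  also have "\<dots> = emb x + stable_letter e + (emb (sub (\<not> e) j) + R)" by (simp add: emb_sub_stable add.assoc)
  finally have R: "R + emb h = emb (sub (\<not> e) j) + R" by (simp add: add.assoc)
  show ?case
  proof (cases "j = 0")
    case True
    then have "R + emb h = R + 0" using R by simp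
    then have "emb h = emb 0" by (simp only: add_left_cancel emb_0)
    then have "h = 0" by (rule emb_inj)
    moreover have "h' + x = 0 + x" using hx True by simp
    then have "h' = 0" by (simp only: add_right_cancel)
    ultimately show ?thesis by auto
  next
    case False
    obtain q i where q: "odd q" "j = q * 2 ^ i" using odd_part_exists[OF False] by blast
    have "- x + (h' + x) + - x = - x + (x + sub e j) + - x" by (simp only: hx)
    then have "- x + h' = sub e j + - x" by (simp add: group_simps del: add_uminus_conv_diff)
    then have h': "odd_class q h'"
      unfolding odd_class_def using q by (intro conjI exI[of _ "- x"] exI[of _ e] exI[of _ i]) simp_all
    have sub: "odd_class q (sub (\<not> e) j)"
      unfolding odd_class_def using q by (intro conjI exI[of _ 0] exI[of _ "\<not> e"] exI[of _ i]) auto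
    have "reduced zs" using Cons.prems(1) by (auto simp: successively_Cons)
    then have "(\<exists>x. x + h = sub (\<not> e) j + x) \<or> (\<exists>q. odd_class q h \<and> odd_class q (sub (\<not> e) j))"
      using Cons.IH R unfolding R_def conj_by_def by blast
    then have "odd_class q h"
      using odd_class_conj[OF _ sub] odd_class_sub q by blast
    then show ?thesis using h' by blast
  qed
qed

text \<open>Solves for y = r/(1 - 2^k). The divisor is at least 1/2 in absolute value; up to sign
  and a power of 2 it is the odd number 2^m - 1, so for dyadic \<open>y\<close> the division adds
  nothing to the denominator.\<close>

lemma dyadic_quotient_bound:
  fixes y r :: real
  assumes "dyadic y" "y * (1 - 2 powi k) = r" "k \<noteq> 0" "r * 2 ^ d = of_int z"
    "\<bar>k\<bar> \<le> int e"
  shows "\<bar>y\<bar> \<le> 2 * \<bar>r\<bar>" "\<exists>w::int. y * 2 ^ (d + e) = of_int w"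
proof -
  define m where "m = nat \<bar>k\<bar>"
  have m: "m > 0" using assms(3) by (simp add: m_def)
  have two: "(2::real) \<le> 2 ^ m" using power_increasing[of 1 m "2::real"] m by simp
  have pow: "2 powi k = (if k > 0 then 2 ^ m else 1 / 2 ^ m :: real)"
    using assms(3) by (auto simp: m_def power_int_def power_one_over inverse_eq_divide)
  have half: "1 / 2 ^ m \<le> (1 / 2 :: real)" by (rule frac_le) (use two in auto)
  have "1 / 2 \<le> \<bar>1 - 2 powi k :: real\<bar>"
  proof (cases "k > 0")
    case True
    then show ?thesis using two unfolding pow by (simp only: if_True)
  next
    case False
    then show ?thesis using half unfolding pow by (simp only: if_False)
  qed
  then have "\<bar>y\<bar> * (1 / 2) \<le> \<bar>y\<bar> * \<bar>1 - 2 powi k\<bar>" by (intro mult_left_mono) auto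
  then show "\<bar>y\<bar> \<le> 2 * \<bar>r\<bar>" using assms(2) by (simp flip: abs_mult)
  obtain u i where y: "y = of_int u / 2 ^ i" using assms(1) by (rule dyadicE)
  have "\<exists>z'::int. y * (2 ^ m - 1) * 2 ^ d = of_int z'"
  proof (cases "k > 0")
    case True
    then have "y * (2 ^ m - 1) = - r" using assms(2) by (simp add: pow algebra_simps)
    then have "y * (2 ^ m - 1) * 2 ^ d = - (r * 2 ^ d)" by simp
    then show ?thesis using assms(4) by (metis of_int_minus)
  next
    case False
    then have "y * (2 ^ m - 1) * 2 ^ d = 2 ^ m * (r * 2 ^ d)"
      using pow by (simp flip: assms(2) add: field_simps)
    then show ?thesis using assms(4) by (metis of_int_mult of_int_numeral of_int_power)
  qed
  then obtain z' :: int where "y * (2 ^ m - 1) * 2 ^ d = of_int z'" by blast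
  then have "of_int (u * (2 ^ m - 1) * 2 ^ d) = (of_int (z' * 2 ^ i) :: real)"
    by (simp add: y field_simps)
  then have "u * (2 ^ m - 1) * 2 ^ d = z' * 2 ^ i" by (simp only: of_int_eq_iff)
  then have "2 ^ i dvd (2 ^ m - 1) * (u * 2 ^ d)" by (metis dvd_triv_right mult.assoc mult.commute)
  moreover have "coprime (2 ^ i) (2 ^ m - 1 :: int)" using m by simp
  ultimately have "2 ^ i dvd u * 2 ^ d" by (simp add: coprime_dvd_mult_right_iff)
  then obtain v where "u * 2 ^ d = 2 ^ i * v" by (rule dvdE)
  from arg_cong[OF this, of real_of_int] have "y * 2 ^ d = of_int v" by (simp add: y field_simps)
  then have "y * 2 ^ (d + e) = of_int (v * 2 ^ e)" by (simp add: power_add)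
  then show "\<exists>w::int. y * 2 ^ (d + e) = of_int w" by blast
qed

lemma word_len_emb_le:
  assumes "transl c * 2 ^ d = of_int z" "\<bar>transl c\<bar> \<le> 2 ^ p" "\<bar>expo c\<bar> \<le> int e"
  shows "word_len (emb c) \<le> 2 ^ (p + d) + 2 * d + e + 6"
proof -
  have "c = bs_of z d (expo c)" by (rule bs_eqI) (simp_all flip: assms(1))
  then have "word_len (emb c) \<le> nat \<bar>z\<bar> + 2 * d + nat \<bar>expo c\<bar> + 6" by (metis word_len_bs_of)
  moreover have "real_of_int \<bar>z\<bar> \<le> of_int (2 ^ (p + d))"
  proof -
    have "real_of_int \<bar>z\<bar> = \<bar>transl c\<bar> * 2 ^ d" by (simp flip: assms(1) add: abs_mult)
    also have "\<dots> \<le> 2 ^ p * 2 ^ d" using assms(2) by (intro mult_right_mono) auto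
    finally show ?thesis by (simp add: power_add)
  qed
  then have "\<bar>z\<bar> \<le> 2 ^ (p + d)" by (simp only: of_int_le_iff)
  then have "nat \<bar>z\<bar> \<le> 2 ^ (p + d)" by (simp add: nat_le_iff)
  moreover have "nat \<bar>expo c\<bar> \<le> e" using assms(3) by simp
  ultimately show ?thesis by linarith
qed

lemma linear_le_power: "7 * f + 10 \<le> 28 * 2 ^ (7 * f)" for f :: nat
  using less_exp[of "7 * f"] by linarith

lemma expo_diff: "expo (x - y) = expo x - expo y"
  unfolding minus_bs_def by (simp del: add_uminus_conv_diff)

text \<open>If the exponent k of \<open>h\<close> is 0, only \<open>expo x\<close> matters, and it
  is determined by a ratio of translations. Otherwise the conjugator may be multiplied by powers of
  \<open>h\<close>, which brings its exponent down to |k|; its translation then solves a linear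
  equation with coefficient 1 - 2^k.\<close>

lemma bs_conj_bounded:
  assumes "x + h = h' + x" "cost n h" "cost n h'"
  shows "\<exists>g. g + h = h' + g \<and> word_len (emb g) \<le> 2 ^ (7 * growth n + 5)"
proof -
  define f where "f = growth n"
  define k where "k = expo h"
  note b = cost_coarse_bounds[OF assms(2), folded f_def] cost_coarse_bounds[OF assms(3), folded f_def]
  have pow: "(2::nat) ^ (7 * f + 5) = 32 * 2 ^ (7 * f)" by (simp add: power_add)
  note lin = linear_le_power[of f]
  have k': "expo h' = k" using assms(1) by (simp add: bs_eq_iff k_def)
  have "\<exists>g. g + h = h' + g \<and> word_len (emb g) \<le> 2 ^ (7 * f + 5)"
  proof (cases "k = 0")
    case k0: True
    show ?thesis
    proof (cases "transl h = 0")
      case True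
      then have "h = 0" "h' = 0" using assms(1) k0 k' by (auto simp: bs_eq_iff k_def)
      then show ?thesis by (intro exI[of _ 0]) simp
    next
      case False
      have eq: "2 powi expo x * transl h = transl h'" using assms(1) k0 k' by (simp add: bs_eq_iff)
      have "\<bar>expo x\<bar> \<le> 3 * int f" using ratio_exponent[OF eq False assms(2,3)] by (simp add: f_def)
      then have "word_len (emb (sub True (expo x))) \<le> 2 ^ (7 * f + 5)"
        using word_len_sub[of True "expo x"] lin unfolding pow by linarith
      moreover have "sub True (expo x) + h = h' + sub True (expo x)"
        by (rule bs_eqI) (simp_all add: eq k0 k' k_def[symmetric])
      ultimately show ?thesis by blast
    qed
  next
    case k0: False
    obtain y where y: "y + h = h' + y" and min: "\<And>y'. y' + h = h' + y' \<Longrightarrow> nat \<bar>expo y\<bar> \<le> nat \<bar>expo y'\<bar>"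
      using ex_has_least_nat[of "\<lambda>y. y + h = h' + y" x "\<lambda>y. nat \<bar>expo y\<bar>"] assms(1) by blast
    \<comment> \<open>Both \<open>y + h\<close> and \<open>y - h\<close> are conjugators too, with
      exponents shifted by k and -k, so minimality confines \<open>expo y\<close>.\<close>
    have "(y + h) + h = h' + (y + h)" using y by (metis add.assoc)
    from min[OF this] have 1: "\<bar>expo y\<bar> \<le> \<bar>expo y + k\<bar>" by (simp add: k_def)
    have "(y - h) + h = (h' + y) - h" by (simp flip: y)
    then have "(y - h) + h = h' + (y - h)" by (simp only: add_diff_eq)
    from min[OF this] have 2: "\<bar>expo y\<bar> \<le> \<bar>expo y - k\<bar>" by (simp add: k_def expo_diff)
    have ey: "\<bar>expo y\<bar> \<le> \<bar>k\<bar>" using 1 2 k0 by linarith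
    have kf: "\<bar>k\<bar> \<le> int f" using b(2) by (simp add: k_def)
    define r where "r = transl h' - 2 powi expo y * transl h"
    have ty: "transl y * (1 - 2 powi k) = r"
      using y k' by (simp add: bs_eq_iff r_def algebra_simps)
    obtain z z' :: int where z: "transl h * 2 ^ f = of_int z" "transl h' * 2 ^ f = of_int z'" using b by meson
    have e: "2 powi expo y * 2 ^ f = (2 ^ nat (expo y + int f) :: real)"
    proof -
      have "2 powi expo y * 2 ^ f = (2 powi (expo y + int f) :: real)" by (simp add: power_int_add)
      then show ?thesis using ey kf by (simp add: power_int_def)
    qed
    have "r * 2 ^ (2 * f) = (transl h' * 2 ^ f) * 2 ^ f - (2 powi expo y * 2 ^ f) * (transl h * 2 ^ f)"
      unfolding r_def mult_2[of f] power_add by (simp add: algebra_simps)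
    also have "\<dots> = of_int (z' * 2 ^ f - 2 ^ nat (expo y + int f) * z)" unfolding z e by simp
    finally have rz: "r * 2 ^ (2 * f) = of_int (z' * 2 ^ f - 2 ^ nat (expo y + int f) * z)" .
    note q = dyadic_quotient_bound[OF dyadic_transl ty k0 rz kf]
    obtain w :: int where w: "transl y * 2 ^ (2 * f + f) = of_int w" using q(2) by blast
    have "2 powi expo y \<le> (2 powi int f :: real)" using ey kf by (intro power_int_increasing) auto
    then have "2 powi expo y * \<bar>transl h\<bar> \<le> 2 ^ f * 2 ^ (2 * f)"
      using b(1) by (intro mult_mono) auto
    moreover have "\<bar>r\<bar> \<le> \<bar>transl h'\<bar> + 2 powi expo y * \<bar>transl h\<bar>"
      using abs_triangle_ineq4[of "transl h'" "2 powi expo y * transl h"] by (simp add: r_def abs_mult)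
    moreover have "(2::real) ^ (2 * f) \<le> 2 ^ (3 * f)" "(2::real) ^ f * 2 ^ (2 * f) = 2 ^ (3 * f)"
      by (auto intro: power_increasing simp flip: power_add)
    ultimately have "\<bar>r\<bar> \<le> 2 * 2 ^ (3 * f)" using b(4) by linarith
    then have "\<bar>transl y\<bar> \<le> 2 ^ (3 * f + 2)" using q(1) by (simp add: power_add)
    moreover have "\<bar>expo y\<bar> \<le> int f" using ey kf by linarith
    \<comment> \<open>Size 2^(3f + 2) times denominator 2^(3f); the exponent 7 f + 5 of the claim
      leaves room for the linear terms.\<close>
    moreover define X :: nat where "X = 2 ^ (3 * f + 2 + (2 * f + f))"
    ultimately have "word_len (emb y) \<le> X + 7 * f + 6"
      using word_len_emb_le[OF w, of "3 * f + 2" f] by (simp add: X_def)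
    moreover have "X \<le> 2 ^ (7 * f + 2)"
      unfolding X_def by (intro power_increasing) auto
    then have "X \<le> 4 * 2 ^ (7 * f)" by (simp add: power_add)
    ultimately have "word_len (emb y) \<le> 2 ^ (7 * f + 5)" using lin unfolding pow by linarith
    then show ?thesis using y by blast
  qed
  then show ?thesis by (simp add: f_def)
qed

text \<open>With exponent 0, a power of s rescales the translation to q. Otherwise a translation
  conjugates \<open>h\<close> to s^k, the letter t^-1 turns this into a^k, and s^-i removes the
  factor 2^i from k.\<close>

lemma odd_class_conj_within:
  assumes "odd_class q h" "cost n h"
  shows "conj_within (2 ^ (7 * growth n + 5)) (emb h) (emb (sub False q))"
proof -
  define f where "f = growth n"
  define k where "k = expo h"
  note b = cost_coarse_bounds[OF assms(2), folded f_def]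
  have pow: "(2::nat) ^ (7 * f + 5) = 32 * 2 ^ (7 * f)" by (simp add: power_add)
  note lin = linear_le_power[of f]
  obtain x e i where q: "odd q" and x: "x + h = sub e (q * 2 ^ i) + x"
    using assms(1) by (auto simp: odd_class_def)
  have q0: "q \<noteq> 0" using q by auto
  have q1: "1 \<le> \<bar>real_of_int q\<bar>" using q0 by linarith
  obtain z :: int where z: "transl h * 2 ^ f = of_int z" using b by blast
  have "conj_within (2 ^ (7 * f + 5)) (emb h) (emb (sub False q))"
  proof (cases "k = 0")
    case True
    then have e: "\<not> e" using x q0 by (auto simp: bs_eq_iff k_def)
    define m where "m = int i - expo x"
    have "2 powi expo x * transl h = of_int q * 2 ^ i" using x e by (simp add: bs_eq_iff)
    then have h: "transl h = of_int q * 2 powi m"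
      by (simp add: m_def power_int_diff field_simps)
    have m2: "2 powi (- m) * transl h = of_int q" by (simp add: h power_int_minus)
    have hn: "transl h \<noteq> 0" using h q0 by simp
    \<comment> \<open>The denominator of \<open>transl h\<close> divides 2^f, so a more negative
      \<open>m\<close> would make \<open>q\<close> even.\<close>
    have "- m \<le> 3 * int f"
    proof (rule ccontr)
      assume "\<not> - m \<le> 3 * int f"
      then have m: "m < 0" "m + int f < 0" by auto
      define p where "p = nat (- m - int f)"
      have "- m = int (p + f)" using m by (simp add: p_def)
      then have "2 powi (- m) = (2 ^ (p + f) :: real)" by (simp only: power_int_of_nat)
      then have "of_int q = 2 ^ p * (transl h * 2 ^ f)"
        using m2 by (simp add: power_add mult.assoc mult.commute mult.left_commute)
      then have "real_of_int q = of_int (2 ^ p * z)" unfolding z by simp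
      then have "q = 2 ^ p * z" by (simp only: of_int_eq_iff)
      moreover have "p > 0" using m by (simp add: p_def)
      ultimately show False using q by simp
    qed
    moreover have "m \<le> 3 * int f"
    proof (rule ratio_exponent_le)
      show "2 powi m * of_int q = transl h" by (simp add: h)
      show "of_int q * 2 ^ f = (of_int (q * 2 ^ f) :: real)" by simp
    qed (use q0 b in auto)
    ultimately have "\<bar>- m\<bar> \<le> 3 * int f" by linarith
    then have "word_len (emb (sub True (- m))) \<le> 2 ^ (7 * f + 5)"
      using word_len_sub[of True "- m"] lin unfolding pow by linarith
    moreover have "sub True (- m) + h = sub False q + sub True (- m)"
      using True m2 by (intro bs_eqI) (simp_all add: k_def)
    then have "conj_by (emb (sub True (- m))) (emb h) (emb (sub False q))"
      by (simp add: conj_by_def flip: emb_add)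
    ultimately show ?thesis by (rule_tac conj_withinI)
  next
    case k0: False
    then have e: "e" using x by (auto simp: bs_eq_iff k_def split: if_splits)
    have k: "k = q * 2 ^ i" using x e by (simp add: bs_eq_iff k_def)
    have kf: "\<bar>k\<bar> \<le> int f" using b(2) by (simp add: k_def)
    \<comment> \<open>The power of s commutes with s^k and can be split off, leaving a pure
      translation as conjugator.\<close>
    define y where "y = - sub True (expo x) + x"
    have "y + h = - sub True (expo x) + (sub True k + x)" using x e k by (simp add: y_def add.assoc)
    also have "\<dots> = (- sub True (expo x) + sub True k) + x" by (simp add: add.assoc)
    also have "- sub True (expo x) + sub True k = sub True k + - sub True (expo x)"
      by (simp flip: sub_minus sub_add)
    finally have y: "y + h = sub True k + y"
      by (simp add: y_def group_simps del: add_uminus_conv_diff)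
    have ey: "expo y = 0" by (simp add: y_def)
    have ty: "transl y * (1 - 2 powi k) = - transl h"
      using y ey by (simp add: bs_eq_iff algebra_simps)
    have mz: "- transl h * 2 ^ f = of_int (- z)" using z by simp
    note d = dyadic_quotient_bound[OF dyadic_transl ty k0 mz kf]
    obtain w :: int where w: "transl y * 2 ^ (f + f) = of_int w" using d(2) by blast
    have "\<bar>transl y\<bar> \<le> 2 ^ (2 * f + 1)" using d(1) b(1) by simp
    moreover have "\<bar>expo y\<bar> \<le> int 0" using ey by simp
    moreover define X :: nat where "X = 2 ^ (2 * f + 1 + (f + f))"
    ultimately have "word_len (emb y) \<le> X + 4 * f + 6"
      using word_len_emb_le[OF w, of "2 * f + 1" 0] by (simp add: X_def)
    moreover have "X \<le> 2 ^ (7 * f + 1)"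
      unfolding X_def by (intro power_increasing) auto
    then have "X \<le> 2 * 2 ^ (7 * f)" by (simp add: power_add)
    ultimately have wy: "word_len (emb y) \<le> 2 * 2 ^ (7 * f) + 4 * f + 6" by linarith
    have c1: "conj_within (2 * 2 ^ (7 * f) + 4 * f + 6) (emb h) (emb (sub True k))"
      using y wy by (intro conj_withinI[of "emb y"]) (simp_all add: conj_by_def flip: emb_add)
    have c2: "conj_within 1 (emb (sub True k)) (emb (sub False k))"
    proof (rule conj_withinI)
      have "emb (sub False k) = - stable_letter True + (emb (sub True k) + stable_letter True)"
        by (simp add: emb_sub_stable)
      then show "conj_by (- stable_letter True) (emb (sub True k)) (emb (sub False k))"
        by (simp add: conj_by_def group_simps del: add_uminus_conv_diff)
    qed (use word_len_stable in simp)
    have "sub True (- int i) + sub False k = sub False q + sub True (- int i)"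
      by (intro bs_eqI) (simp_all add: k power_int_minus)
    moreover have "int i \<le> int f"
    proof -
      have "int i < 2 ^ i" by (rule int_less_two_power)
      also have "\<dots> \<le> \<bar>q\<bar> * 2 ^ i" using q0 by simp
      also have "\<dots> = \<bar>k\<bar>" by (simp add: k abs_mult)
      finally show ?thesis using kf by simp
    qed
    then have "word_len (emb (sub True (- int i))) \<le> f + 2"
      using word_len_sub[of True "- int i"] by linarith
    ultimately have c3: "conj_within (f + 2) (emb (sub False k)) (emb (sub False q))"
      by (intro conj_withinI[of "emb (sub True (- int i))"]) (simp_all add: conj_by_def flip: emb_add)
    show ?thesis using conj_within_trans[OF conj_within_trans[OF c1 c2] c3]
      by (rule conj_within_mono) (use lin pow in linarith)
  qed
  then show ?thesis by (simp add: f_def)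
qed

lemma elliptic_conj_within:
  assumes "conj_by g (emb h) (emb h')" "cost n h" "cost n h'"
  shows "conj_within (2 * 2 ^ (7 * growth n + 5)) (emb h) (emb h')"
proof -
  obtain k where "syl_form k g" by (rule syl_form_total)
  then obtain x zs where g: "g = emb x + seq_val zs" "reduced zs" by (auto simp: syl_form_def)
  from elliptic_conj[OF g(2) assms(1)[unfolded g(1)]] show ?thesis
  proof
    assume "\<exists>x. x + h = h' + x"
    then obtain y where "y + h = h' + y" "word_len (emb y) \<le> 2 ^ (7 * growth n + 5)"
      using bs_conj_bounded assms(2,3) by blast
    then show ?thesis
      by (intro conj_withinI[of "emb y"]) (simp_all add: conj_by_def flip: emb_add)
  next
    assume "\<exists>q. odd_class q h \<and> odd_class q h'"
    then obtain q where "odd_class q h" "odd_class q h'" by blast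
    from conj_within_trans[OF odd_class_conj_within[OF this(1) assms(2)]
        conj_within_sym[OF odd_class_conj_within[OF this(2) assms(3)]]]
    show ?thesis by (rule conj_within_mono) simp
  qed
qed

section \<open>The upper bound\<close>

lemma le_growth: "n \<le> growth n"
  by (cases "n = 0") (simp_all add: growth_pos)

lemma conj_within_growth:
  assumes "conj_by g u v" "word_len u + word_len v \<le> n"
  shows "conj_within (2 ^ (7 * growth n + 7)) u v"
proof -
  define f where "f = growth n"
  \<comment> \<open>The price of cyclic reduction: at most n stable letters, with n + 1 allowed for
    each.\<close>
  define K where "K = n * (n + 1)"
  have split: "(\<exists>h. cost n h \<and> conj_within K g (emb h)) \<or>
    (\<exists>xs. xs \<noteq> [] \<and> cyc_reduced xs \<and> seq_cost n xs \<and> conj_within K g (seq_val xs))"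
    if "word_len g \<le> n" for g
  proof -
    obtain w where w: "abs_bg w = g" "length w = word_len g" by (rule word_len_witness)
    obtain h xs c d where g: "abs_bg w = emb h + seq_val xs" "reduced xs" "cost c h" "seq_cost d xs"
      "c + d \<le> length w" by (rule reduced_decomposition)
    have cd: "c + d \<le> n" using g(5) w(2) that by simp
    have le: "length xs * (n + 1) \<le> K"
      using length_seq_cost[OF g(4)] cd unfolding K_def by (intro mult_right_mono) auto
    then show ?thesis
      using cyclic_reduction[OF g(2,3,4) cd] conj_within_mono[OF _ le]
      unfolding w(1)[symmetric] g(1) by blast
  qed
  have bound: "K + L + K \<le> 2 ^ (7 * f + 7)" if "L \<le> 64 * 2 ^ (7 * f)" for L
  proof -
    have "n \<le> 2 ^ f" using le_growth[of n] less_exp[of f] unfolding f_def by linarith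
    moreover have "n + 1 \<le> 2 * 2 ^ f" using calculation one_le_power[of "2::nat" f] by linarith
    ultimately have "K \<le> 2 ^ f * (2 * 2 ^ f)" unfolding K_def by (intro mult_mono) auto
    also have "\<dots> = 2 * 2 ^ (2 * f)" unfolding mult_2[of f] power_add by simp
    also have "\<dots> \<le> 2 * 2 ^ (7 * f)" by (simp add: power_increasing)
    finally show ?thesis using that by (simp add: power_add)
  qed
  have conclude: "conj_within (2 ^ (7 * f + 7)) u v"
    if "conj_within K u u'" "conj_within K v v'" "conj_within L u' v'" "L \<le> 64 * 2 ^ (7 * f)" for u' v' L
    using conj_within_trans[OF conj_within_trans[OF that(1,3)] conj_within_sym[OF that(2)]] bound[OF that(4)]
    by (rule conj_within_mono)
  have transport: "\<exists>g'. conj_by g' u' v'" if "conj_within K u u'" "conj_within K v v'" for u' v'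
    using that assms(1) unfolding conj_within_def by (meson conj_by_sym conj_by_trans)
  have mixed: False if "conj_by g' (emb h) (seq_val xs)" "xs \<noteq> []" "cyc_reduced xs" for g' h xs
    using syl_form_total[of g'] elliptic_not_hyperbolic[OF _ that] by metis
  have lens: "word_len u \<le> n" "word_len v \<le> n" using assms(2) by auto
  have "conj_within (2 ^ (7 * f + 7)) u v"
    using split[OF lens(1)] split[OF lens(2)]
  proof (elim disjE exE conjE)
    fix h h' assume 1: "cost n h" "conj_within K u (emb h)" "cost n h'" "conj_within K v (emb h')"
    obtain g' where "conj_by g' (emb h) (emb h')" using transport 1 by blast
    from elliptic_conj_within[OF this 1(1,3)] show ?thesis
      by (rule conclude[OF 1(2,4)]) (simp add: f_def power_add)
  next
    fix h xs assume 1: "conj_within K u (emb h)" "xs \<noteq> []" "cyc_reduced xs" "conj_within K v (seq_val xs)"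
    then show ?thesis using transport mixed by blast
  next
    fix h xs assume 1: "conj_within K v (emb h)" "xs \<noteq> []" "cyc_reduced xs" "conj_within K u (seq_val xs)"
    then show ?thesis using transport mixed conj_by_sym by blast
  next
    fix xs ys assume 1: "xs \<noteq> []" "cyc_reduced xs" "seq_cost n xs" "conj_within K u (seq_val xs)"
      "ys \<noteq> []" "cyc_reduced ys" "seq_cost n ys" "conj_within K v (seq_val ys)"
    obtain g' where "conj_by g' (seq_val xs) (seq_val ys)" using transport 1 by blast
    from hyperbolic_conj[OF this 1(1,5,2,6,3,7)] show ?thesis
    proof (rule conclude[OF 1(4,8)])
      have "n \<le> 2 ^ (7 * f)" using le_growth[of n] less_exp[of "7 * f"] unfolding f_def by linarith
      moreover have "(2::nat) ^ (3 * f) \<le> 2 ^ (7 * f)" by (simp add: power_increasing)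
      moreover have "(1::nat) \<le> 2 ^ (7 * f)" by simp
      ultimately show "4 * n + 2 ^ (3 * growth n + 1) + 2 \<le> 64 * 2 ^ (7 * f)"
        unfolding f_def[symmetric] power_add power_one_right by linarith
    qed
  qed
  then show ?thesis by (simp add: f_def)
qed

text \<open>The slack k + 2 absorbs the factor 2^(k + 1) of the next step and leaves a factor 2,
  which pays for the next slack.\<close>

lemma growth_power_two: "growth (2 ^ k) + k + 2 \<le> iter_exp (k + 2) 1"
proof (induction k)
  case 0
  show ?case by (simp add: growth.simps numeral_2_eq_2)
next
  case (Suc k)
  have "growth (2 ^ Suc k) = 2 ^ (Suc k + growth (2 ^ k))"
    by (subst growth_pos) (simp_all add: power_add)
  moreover have "k + 3 \<le> 2 ^ (Suc k + growth (2 ^ k))"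
  proof -
    have "1 \<le> growth (2 ^ k)" using le_growth[of "2 ^ k"] one_le_power[of "2::nat" k] by linarith
    then have "(2::nat) ^ (k + 2) \<le> 2 ^ (Suc k + growth (2 ^ k))" by (intro power_increasing) auto
    then show ?thesis using less_exp[of "k + 2"] by linarith
  qed
  moreover have "2 * 2 ^ (Suc k + growth (2 ^ k)) \<le> iter_exp (Suc k + 2) 1"
    using power_increasing[OF Suc, of "2::nat"] by (simp add: power_add algebra_simps)
  ultimately show ?case by linarith
qed

text \<open>The factor 8 raises the tower by three levels: one for rounding \<open>m\<close> up to a
  power of 2 and two from \<open>growth_power_two\<close>.\<close>

lemma growth_le_tower_log: "growth m \<le> tower_log (8 * m)"
proof (cases "m = 0")
  case False
  define k where "k = nat \<lfloor>log 2 (real m)\<rfloor>"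
  have pos: "0 \<le> log 2 (real m)" using False by simp
  have "log 2 (real m) < real (k + 1)" unfolding k_def using pos by linarith
  then have "real m < 2 powr real (k + 1)" using False by (simp add: log_less_iff)
  then have "real m < 2 ^ (k + 1)" by (simp only: powr_realpow)
  then have "real m < real (2 ^ (k + 1))" by simp
  then have "m \<le> 2 ^ (k + 1)" by (simp only: of_nat_less_iff)
  then have "growth m \<le> growth (2 ^ (k + 1))" by (rule growth_mono)
  also have "\<dots> \<le> iter_exp (k + 1 + 2) 1" using growth_power_two[of "k + 1"] by linarith
  also have "k + 1 + 2 = nat \<lfloor>log 2 (real (8 * m))\<rfloor>"
  proof -
    have "log 2 (8::real) = 3" using log_pow_cancel[of "2::real" 3] by simp
    then have "log 2 (real (8 * m)) = log 2 (real m) + 3" using False by (simp add: log_mult)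
    then show ?thesis using pos by (simp add: k_def nat_add_distrib)
  qed
  finally show ?thesis using False by (simp add: tower_log_def)
qed simp

lemma growth_mult: "j * growth n \<le> growth (j * n)"
proof (induction j)
  case (Suc j)
  then show ?case using growth_add[of n "j * n"] by simp
qed simp

text \<open>An exponential is absorbed by doubling the argument of \<open>growth\<close>. The
  constant 112 is 7 for the exponent 7 growth n + 7, times this 2, times the 8 of
  \<open>growth_le_tower_log\<close>.\<close>

lemma CL_bg_upper: "CL bg_relators n \<le> tower_log (112 * n + 112)"
proof -
  have "CL bg_relators n \<le> 2 ^ (7 * growth n + 7)"
    using conj_within_growth unfolding conj_within_def by (intro CL_bg_le) blast
  also have "7 * growth n + 7 \<le> growth (7 * n + 7)"
    using growth_mult[of 7 n] le_growth[of 7] growth_add[of "7 * n" 7] by linarith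
  then have "(2::nat) ^ (7 * growth n + 7) \<le> 2 ^ growth (7 * n + 7)" by (intro power_increasing) auto
  also have "\<dots> \<le> growth (14 * n + 14)" by (subst (2) growth_pos) simp_all
  also have "\<dots> \<le> tower_log (8 * (14 * n + 14))" by (rule growth_le_tower_log)
  finally show ?thesis by simp
qed

theorem theorem1p4: "CL bg_relators \<simeq> tower_log"
  unfolding growth_equiv_def
proof
  show "CL bg_relators \<preceq> tower_log"
    unfolding growth_le_def
  proof (intro exI[of _ 112] conjI allI)
    show "CL bg_relators n \<le> 112 * tower_log (112 * n + 112) + 112 * n + 112" for n
      using CL_bg_upper[of n] by linarith
  qed simp
  show "tower_log \<preceq> CL bg_relators" by (rule tower_log_le_CL)
qed

end
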